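(* Let $(\mathcal{H},[\cdot,\cdot])$ be a Krein space with fundamental symmetry $J$, and let $S$ be a boundedly invertible $J$-selfadjoint operator on $\mathcal{H}$. Then the following conditions are equivalent: 1. $S$ is a $J$-frame operator, i.e. there exists a $J$-frame $\mathcal{F}$ for $\mathcal{H}$ with synthesis operator $T$ such that $S=TT^{\#}$. 2. There exists a projection $Q\in\mathcal{Q}$ such that $QS$ is $J$-positive and $(I-Q)S$ is $J$-negative. 3. There exist $J$-positive operators $S_1,S_2\in L(\mathcal{H})$ such that $S=S_1-S_2$, $R(S_1)$ is a uniformly $J$-positive subspace of $\mathcal{H}$ and $R(S_2)$ is a uniformly $J$-negative subspace of $\mathcal{H}$.
   Context: Krein space setting: $(\mathcal{H},[\cdot,\cdot])$ is a complex separable Krein space with a fixed fundamental decomposition $\mathcal{H}=\mathcal{H}_+\dotplus\mathcal{H}_-$ (the summands are $[\cdot,\cdot]$-orthogonal and $(\mathcal{H}_\pm,\pm[\cdot,\cdot])$ are Hilbert spaces). $\langle\cdot,\cdot\rangle$ is the inner product making $\mathcal{H}$ the orthogonal direct sum of these Hilbert spaces, $\|\cdot\|$ its norm, and the fundamental symmetry $J$ (a selfadjoint unitary) satisfies $[x,y]=\langle Jx,y\rangle$. $L(\mathcal{H})$ is the algebra of bounded linear operators; $R(\cdot)$, $N(\cdot)$ denote range and nullspace, and $*$ denotes Hilbert space adjoints. For $T\in L(\mathcal{H}_1,\mathcal{H}_2)$ between Krein spaces with fundamental symmetries $J_1,J_2$, the $J$-adjoint is $T^{\#}=J_1T^*J_2$.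 $A\in L(\mathcal{H})$ is $J$-selfadjoint if $A^{\#}=A$; $J$-positive if $[Af,f]\ge 0$ for all $f\in\mathcal{H}$; $J$-negative if $[Af,f]\le 0$ for all $f\in\mathcal{H}$. A subspace $\mathcal{S}$ is uniformly $J$-positive (resp. uniformly $J$-negative) if there is $\alpha>0$ with $[x,x]\ge\alpha\|x\|^2$ (resp. $[x,x]\le-\alpha\|x\|^2$) for all $x\in\mathcal{S}$. "Maximal" means maximal with respect to inclusion among such subspaces. $\mathcal{Q}=\{Q\in L(\mathcal{H}): Q^2=Q,\ R(Q)\text{ is uniformly } J\text{-positive and } N(Q)\text{ is uniformly } J\text{-negative}\}$. A Bessel family is a family $\mathcal{F}=\{f_i\}_{i\in I}$ in $\mathcal{H}$ with $\sum_i|\langle f,f_i\rangle|^2\le B\|f\|^2$ for all $f$ and some $B<\infty$. Its synthesis operator is $T\in L(\ell_2(I),\mathcal{H})$, $Te_i=f_i$, with $\{e_i\}$ the standard orthonormal basis. Let $I_+=\{i:[f_i,f_i]\ge0\}$, $I_-=\{i:[f_i,f_i]<0\}$, $P_\pm$ the orthogonal projection of $\ell_2(I)$ onto $\ell_2(I_\pm)$, and $T_\pm=TP_\pm$. The Bessel family $\mathcal{F}$ is a $J$-frame for $\mathcal{H}$ if $R(T_+)$ is a maximal uniformly $J$-positive subspace and $R(T_-)$ is a maximal uniformly $J$-negative subspace of $\mathcal{H}$. When $\mathcal{F}$ is a $J$-frame, $\ell_2(I)$ is regarded as a Krein space with fundamental symmetry $J_2e_i=\sigma_ie_i$, where $\sigma_i=1$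 for $i\in I_+$ and $\sigma_i=-1$ for $i\in I_-$. Hence $T^{\#}=J_2T^*J$. *)

theory Defs
  imports "HOL-Analysis.Analysis"
begin

section \<open>Complex Hilbert spaces\<close>

text \<open>
  The inner product is linear in the first argument. The norm of the type is the one induced by
  \<open>cinner\<close>: the last assumption and \<open>cinner_commute\<close> give \<open>cinner x x = (norm x)\<^sup>2\<close>.
\<close>

class complex_hilbert_space = real_inner + complete_space +
  fixes scaleC :: "complex \<Rightarrow> 'a \<Rightarrow> 'a"  (infixr \<open>*\<^sub>C\<close> 75)
    and cinner :: "'a \<Rightarrow> 'a \<Rightarrow> complex"
  assumes scaleC_add_right: "c *\<^sub>C (x + y) = c *\<^sub>C x + c *\<^sub>C y"
    and scaleC_add_left: "(c + d) *\<^sub>C x = c *\<^sub>C x + d *\<^sub>C x"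
    and scaleC_scaleC: "c *\<^sub>C d *\<^sub>C x = (c * d) *\<^sub>C x"
    and scaleC_of_real: "complex_of_real r *\<^sub>C x = r *\<^sub>R x"
    and cinner_add_left: "cinner (x + y) z = cinner x z + cinner y z"
    and cinner_scaleC_left: "cinner (c *\<^sub>C x) y = c * cinner x y"
    and cinner_commute: "cinner y x = cnj (cinner x y)"
    and Re_cinner: "Re (cinner x y) = inner x y"

interpretation complex_vector:
  vector_space "scaleC :: complex \<Rightarrow> 'a \<Rightarrow> 'a::complex_hilbert_space"
  by unfold_locales
    (auto simp: scaleC_add_right scaleC_add_left scaleC_scaleC
      scaleC_of_real[of 1, simplified])

definition bounded_clinear ::
    "('a::complex_hilbert_space \<Rightarrow> 'b::complex_hilbert_space) \<Rightarrow> bool"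
  where "bounded_clinear A \<longleftrightarrow> bounded_linear A \<and> (\<forall>c x. A (c *\<^sub>C x) = c *\<^sub>C A x)"

definition boundedly_invertible :: "('a::complex_hilbert_space \<Rightarrow> 'a) \<Rightarrow> bool"
  where "boundedly_invertible A \<longleftrightarrow>
    bounded_clinear A \<and> (\<exists>B. bounded_clinear B \<and> A \<circ> B = id \<and> B \<circ> A = id)"

text \<open>
  Hilbert space adjoint of an operator \<open>T\<close> from a Hilbert space with carrier \<open>V\<close> and inner
  product \<open>ipV\<close> to one that is a whole type, with inner product \<open>ipW\<close>. The carrier is explicit
  because \<open>\<ell>\<^sub>2(I)\<close> is a set of functions below and not a type.
\<close>

definition hilbert_adjoint ::
    "'v set \<Rightarrow> ('v \<Rightarrow> 'v \<Rightarrow> complex) \<Rightarrow> ('w \<Rightarrow> 'w \<Rightarrow> complex) \<Rightarrow> ('v \<Rightarrow> 'w) \<Rightarrow> 'w \<Rightarrow> 'v"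
  where "hilbert_adjoint V ipV ipW T w = (THE v. v \<in> V \<and> (\<forall>x\<in>V. ipW (T x) w = ipV x v))"

section \<open>Krein spaces\<close>

text \<open>
  \<open>ip\<close> is the indefinite inner product, \<open>Hp\<close> and \<open>Hm\<close> the summands of the fixed fundamental
  decomposition, and \<open>J\<close> the fundamental symmetry. By \<open>cinner_decomp\<close> the Hilbert space structure
  of the type is the one that makes it the orthogonal direct sum of \<open>(Hp, ip)\<close> and \<open>(Hm, -ip)\<close>;
  in particular the norm of the type restricts to the norms of these two spaces, so that \<open>complete\<close>
  expresses their completeness.
\<close>

locale krein_space =
  fixes ip :: "'a::complex_hilbert_space \<Rightarrow> 'a \<Rightarrow> complex"
    and Hp Hm :: "'a set"
    and J :: "'a \<Rightarrow> 'a"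
  assumes separable: "separable_space (euclidean :: 'a topology)"
    and ip_add_left: "ip (x + y) z = ip x z + ip y z"
    and ip_scaleC_left: "ip (c *\<^sub>C x) y = c * ip x y"
    and ip_commute: "ip y x = cnj (ip x y)"
    and subspace_Hp: "complex_vector.subspace Hp"
    and subspace_Hm: "complex_vector.subspace Hm"
    and Hp_Hm_disjoint: "Hp \<inter> Hm = {0}"
    and Hp_Hm_sum: "\<exists>p\<in>Hp. \<exists>m\<in>Hm. x = p + m"
    and ip_orthogonal: "p \<in> Hp \<Longrightarrow> m \<in> Hm \<Longrightarrow> ip p m = 0"
    and Hp_positive: "p \<in> Hp \<Longrightarrow> p \<noteq> 0 \<Longrightarrow> 0 < Re (ip p p)"
    and Hm_negative: "m \<in> Hm \<Longrightarrow> m \<noteq> 0 \<Longrightarrow> Re (ip m m) < 0"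
    and complete_Hp: "complete Hp"
    and complete_Hm: "complete Hm"
    and cinner_decomp: "p \<in> Hp \<Longrightarrow> p' \<in> Hp \<Longrightarrow> m \<in> Hm \<Longrightarrow> m' \<in> Hm \<Longrightarrow>
      cinner (p + m) (p' + m') = ip p p' - ip m m'"
    and ip_eq_cinner_J: "ip x y = cinner (J x) y"

text \<open>The \<open>J\<close>-adjoint \<open>T\<^sup># = J\<^sub>1 T\<^sup>* J\<^sub>2\<close> of an operator \<open>T\<close> between Krein spaces.\<close>

definition J_adjoint ::
    "'v set \<Rightarrow> ('v \<Rightarrow> 'v \<Rightarrow> complex) \<Rightarrow> ('v \<Rightarrow> 'v) \<Rightarrow> ('w \<Rightarrow> 'w \<Rightarrow> complex) \<Rightarrow> ('w \<Rightarrow> 'w) \<Rightarrow>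
      ('v \<Rightarrow> 'w) \<Rightarrow> 'w \<Rightarrow> 'v"
  where "J_adjoint V ipV J1 ipW J2 T = J1 \<circ> hilbert_adjoint V ipV ipW T \<circ> J2"

definition J_selfadjoint ::
    "('a::complex_hilbert_space \<Rightarrow> 'a) \<Rightarrow> ('a \<Rightarrow> 'a) \<Rightarrow> bool"
  where "J_selfadjoint J A \<longleftrightarrow>
    bounded_clinear A \<and> J_adjoint UNIV cinner J cinner J A = A"

definition J_positive ::
    "('a::complex_hilbert_space \<Rightarrow> 'a \<Rightarrow> complex) \<Rightarrow> ('a \<Rightarrow> 'a) \<Rightarrow> bool"
  where "J_positive ip A \<longleftrightarrow> bounded_clinear A \<and> (\<forall>x. ip (A x) x \<in> \<real>\<^sub>\<ge>\<^sub>0)"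

definition J_negative ::
    "('a::complex_hilbert_space \<Rightarrow> 'a \<Rightarrow> complex) \<Rightarrow> ('a \<Rightarrow> 'a) \<Rightarrow> bool"
  where "J_negative ip A \<longleftrightarrow> bounded_clinear A \<and> (\<forall>x. ip (A x) x \<in> \<real>\<^sub>\<le>\<^sub>0)"

text \<open>In the following, \<open>ip x x\<close> is real because \<open>ip\<close> is Hermitian.\<close>

definition uniformly_J_positive ::
    "('a::complex_hilbert_space \<Rightarrow> 'a \<Rightarrow> complex) \<Rightarrow> 'a set \<Rightarrow> bool"
  where "uniformly_J_positive ip M \<longleftrightarrow> complex_vector.subspace M \<and>
    (\<exists>\<alpha>>0. \<forall>x\<in>M. Re (ip x x) \<ge> \<alpha> * (norm x)\<^sup>2)"

definition uniformly_J_negative ::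
    "('a::complex_hilbert_space \<Rightarrow> 'a \<Rightarrow> complex) \<Rightarrow> 'a set \<Rightarrow> bool"
  where "uniformly_J_negative ip M \<longleftrightarrow> complex_vector.subspace M \<and>
    (\<exists>\<alpha>>0. \<forall>x\<in>M. Re (ip x x) \<le> - \<alpha> * (norm x)\<^sup>2)"

definition maximal_uniformly_J_positive ::
    "('a::complex_hilbert_space \<Rightarrow> 'a \<Rightarrow> complex) \<Rightarrow> 'a set \<Rightarrow> bool"
  where "maximal_uniformly_J_positive ip M \<longleftrightarrow> uniformly_J_positive ip M \<and>
    (\<forall>N. uniformly_J_positive ip N \<and> M \<subseteq> N \<longrightarrow> N = M)"

definition maximal_uniformly_J_negative ::
    "('a::complex_hilbert_space \<Rightarrow> 'a \<Rightarrow> complex) \<Rightarrow> 'a set \<Rightarrow> bool"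
  where "maximal_uniformly_J_negative ip M \<longleftrightarrow> uniformly_J_negative ip M \<and>
    (\<forall>N. uniformly_J_negative ip N \<and> M \<subseteq> N \<longrightarrow> N = M)"

definition Q_projections ::
    "('a::complex_hilbert_space \<Rightarrow> 'a \<Rightarrow> complex) \<Rightarrow> ('a \<Rightarrow> 'a) set"
  where "Q_projections ip = {Q. bounded_clinear Q \<and> Q \<circ> Q = Q \<and>
    uniformly_J_positive ip (range Q) \<and> uniformly_J_negative ip {x. Q x = 0}}"

section \<open>The space \<open>\<ell>\<^sub>2(I)\<close>\<close>

text \<open>
  The elements of \<open>\<ell>\<^sub>2(I)\<close>, for an index set \<open>I\<close>, are the square-summable functions that vanish
  outside \<open>I\<close>, so that distinct functions are distinct elements.
\<close>

definition ell2 :: "'i set \<Rightarrow> ('i \<Rightarrow> complex) set"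
  where "ell2 I = {x. (\<forall>i. i \<notin> I \<longrightarrow> x i = 0) \<and> (\<lambda>i. (cmod (x i))\<^sup>2) summable_on I}"

definition ell2_inner :: "'i set \<Rightarrow> ('i \<Rightarrow> complex) \<Rightarrow> ('i \<Rightarrow> complex) \<Rightarrow> complex"
  where "ell2_inner I x y = (\<Sum>\<^sub>\<infinity>i\<in>I. x i * cnj (y i))"

definition ell2_norm :: "'i set \<Rightarrow> ('i \<Rightarrow> complex) \<Rightarrow> real"
  where "ell2_norm I x = sqrt (\<Sum>\<^sub>\<infinity>i\<in>I. (cmod (x i))\<^sup>2)"

definition ell2_basis :: "'i \<Rightarrow> 'i \<Rightarrow> complex"
  where "ell2_basis i = (\<lambda>j. if j = i then 1 else 0)"

text \<open>The orthogonal projection onto \<open>\<ell>\<^sub>2(K)\<close>, for \<open>K \<subseteq> I\<close>.\<close>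

definition ell2_proj :: "'i set \<Rightarrow> ('i \<Rightarrow> complex) \<Rightarrow> 'i \<Rightarrow> complex"
  where "ell2_proj K x = (\<lambda>i. if i \<in> K then x i else 0)"

text \<open>Membership of \<open>T\<close> in \<open>L(\<ell>\<^sub>2(I), H)\<close>; the values of \<open>T\<close> outside \<open>ell2 I\<close> are irrelevant.\<close>

definition ell2_bounded_clinear ::
    "'i set \<Rightarrow> (('i \<Rightarrow> complex) \<Rightarrow> 'a::complex_hilbert_space) \<Rightarrow> bool"
  where "ell2_bounded_clinear I T \<longleftrightarrow>
    (\<forall>x\<in>ell2 I. \<forall>y\<in>ell2 I. T (\<lambda>i. x i + y i) = T x + T y) \<and>
    (\<forall>c. \<forall>x\<in>ell2 I. T (\<lambda>i. c * x i) = c *\<^sub>C T x) \<and>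
    (\<exists>C. \<forall>x\<in>ell2 I. norm (T x) \<le> C * ell2_norm I x)"

section \<open>\<open>J\<close>-frames\<close>

definition Bessel_family :: "'i set \<Rightarrow> ('i \<Rightarrow> 'a::complex_hilbert_space) \<Rightarrow> bool"
  where "Bessel_family I f \<longleftrightarrow> (\<exists>B. \<forall>h.
    (\<lambda>i. (cmod (cinner h (f i)))\<^sup>2) summable_on I \<and>
    (\<Sum>\<^sub>\<infinity>i\<in>I. (cmod (cinner h (f i)))\<^sup>2) \<le> B * (norm h)\<^sup>2)"

definition synthesis_operator ::
    "'i set \<Rightarrow> ('i \<Rightarrow> 'a::complex_hilbert_space) \<Rightarrow> (('i \<Rightarrow> complex) \<Rightarrow> 'a) \<Rightarrow> bool"
  where "synthesis_operator I f T \<longleftrightarrow>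
    ell2_bounded_clinear I T \<and> (\<forall>i\<in>I. T (ell2_basis i) = f i)"

definition index_pos ::
    "('a::complex_hilbert_space \<Rightarrow> 'a \<Rightarrow> complex) \<Rightarrow> 'i set \<Rightarrow> ('i \<Rightarrow> 'a) \<Rightarrow> 'i set"
  where "index_pos ip I f = {i \<in> I. 0 \<le> Re (ip (f i) (f i))}"

definition index_neg ::
    "('a::complex_hilbert_space \<Rightarrow> 'a \<Rightarrow> complex) \<Rightarrow> 'i set \<Rightarrow> ('i \<Rightarrow> 'a) \<Rightarrow> 'i set"
  where "index_neg ip I f = {i \<in> I. Re (ip (f i) (f i)) < 0}"

definition J_frame ::
    "('a::complex_hilbert_space \<Rightarrow> 'a \<Rightarrow> complex) \<Rightarrow> 'i set \<Rightarrow> ('i \<Rightarrow> 'a) \<Rightarrow> bool"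
  where "J_frame ip I f \<longleftrightarrow> Bessel_family I f \<and> (\<exists>T. synthesis_operator I f T \<and>
    maximal_uniformly_J_positive ip ((T \<circ> ell2_proj (index_pos ip I f)) ` ell2 I) \<and>
    maximal_uniformly_J_negative ip ((T \<circ> ell2_proj (index_neg ip I f)) ` ell2 I))"

definition ell2_symmetry ::
    "('a::complex_hilbert_space \<Rightarrow> 'a \<Rightarrow> complex) \<Rightarrow> 'i set \<Rightarrow> ('i \<Rightarrow> 'a) \<Rightarrow>
      ('i \<Rightarrow> complex) \<Rightarrow> 'i \<Rightarrow> complex"
  where "ell2_symmetry ip I f x = (\<lambda>i. (if i \<in> index_pos ip I f then 1 else - 1) * x i)"

text \<open>
  \<open>S\<close> is a \<open>J\<close>-frame operator if it has the form \<open>T T\<^sup>#\<close> for the synthesis operator \<open>T\<close> of a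
  \<open>J\<close>-frame. A formula cannot quantify over the type of the indices, so the universe \<open>'i\<close> from
  which index sets are taken is a parameter. If \<open>'i\<close> is infinite and the space separable, the choice
  of \<open>'i\<close> does not matter: all but countably many members of a Bessel family vanish, and vanishing
  members contribute neither to the ranges of \<open>T\<^sub>+\<close> and \<open>T\<^sub>-\<close> nor to \<open>T T\<^sup>#\<close>.
\<close>

definition J_frame_operator ::
    "'i itself \<Rightarrow> ('a::complex_hilbert_space \<Rightarrow> 'a \<Rightarrow> complex) \<Rightarrow> ('a \<Rightarrow> 'a) \<Rightarrow> ('a \<Rightarrow> 'a) \<Rightarrow> bool"
  where "J_frame_operator _ ip J S \<longleftrightarrow> (\<exists>(I :: 'i set) f T.
    J_frame ip I f \<and> synthesis_operator I f T \<and>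
    S = T \<circ> J_adjoint (ell2 I) (ell2_inner I) (ell2_symmetry ip I f) cinner J T)"

end

theory Submission
  imports Defs
begin

text \<open>
  For a \<open>J\<close>-frame, splitting the sum \<open>T T\<^sup>#\<close> according to the signs of the indices writes it as
  \<open>S\<^sub>1 - S\<^sub>2\<close> with \<open>S\<^sub>1, S\<^sub>2\<close> \<open>J\<close>-positive and ranges in \<open>R(T\<^sub>+)\<close>, \<open>R(T\<^sub>-)\<close>. If
  \<open>S = S\<^sub>1 - S\<^sub>2\<close> is surjective, the whole space is the direct sum of the definite subspaces
  \<open>R(S\<^sub>1)\<close> and \<open>R(S\<^sub>2)\<close>, and the corresponding projection \<open>Q\<close> is bounded. Conversely, given \<open>Q\<close>, the
  operators \<open>QSJ\<close> and \<open>-(I - Q)SJ\<close> are positive. Since the space is separable, each of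
  them has the form \<open>\<Sum>\<^sub>n \<langle>\<cdot>, f\<^sub>n\<rangle> f\<^sub>n\<close>, which Gaussian elimination yields without recourse to
  square roots of operators. The nonzero vectors of the two expansions together form the required
  \<open>J\<close>-frame; its synthesis operators have ranges \<open>R(Q)\<close> and \<open>N(Q)\<close>, and these are maximal
  because they are complementary.
\<close>

section \<open>Complex Hilbert spaces\<close>

instance complex_hilbert_space \<subseteq> banach ..

lemma cinner_add_right: "cinner x (y + z) = cinner x y + cinner x z"
  by (metis cinner_add_left cinner_commute complex_cnj_add)

lemma cinner_scaleC_right: "cinner x (c *\<^sub>C y) = cnj c * cinner x y"
  by (metis cinner_commute cinner_scaleC_left complex_cnj_mult)

lemma scaleC_scaleR_commute: "c *\<^sub>C r *\<^sub>R x = r *\<^sub>R c *\<^sub>C x"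
  by (metis complex_vector.scale_left_commute scaleC_of_real)

lemma scaleC_scaleR_left: "(r *\<^sub>R c) *\<^sub>C x = r *\<^sub>R c *\<^sub>C x"
  by (metis scaleC_of_real scaleC_scaleC scaleR_conv_of_real)

lemma cinner_scaleR_left: "cinner (r *\<^sub>R x) y = r *\<^sub>R cinner x y"
  by (metis cinner_scaleC_left scaleC_of_real scaleR_conv_of_real)

lemma cinner_scaleR_right: "cinner x (r *\<^sub>R y) = r *\<^sub>R cinner x y"
  by (metis cinner_commute cinner_scaleR_left complex_cnj_scaleR)

lemma cinner_self: "cinner x x = complex_of_real ((norm x)\<^sup>2)"
proof (rule complex_eqI)
  show "Re (cinner x x) = Re (complex_of_real ((norm x)\<^sup>2))"
    by (simp add: Re_cinner power2_norm_eq_inner)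
  have "cnj (cinner x x) = cinner x x"
    by (rule cinner_commute[symmetric])
  then show "Im (cinner x x) = Im (complex_of_real ((norm x)\<^sup>2))"
    by (simp add: complex_eq_iff)
qed

lemma norm_scaleC: "norm (c *\<^sub>C x) = cmod c * norm (x :: 'a::complex_hilbert_space)"
proof -
  have "complex_of_real ((norm (c *\<^sub>C x))\<^sup>2) = c * cnj c * cinner x x"
    unfolding cinner_self[symmetric] by (simp add: cinner_scaleC_left cinner_scaleC_right)
  also have "\<dots> = complex_of_real ((cmod c * norm x)\<^sup>2)"
    by (simp add: cinner_self complex_norm_square[symmetric] power_mult_distrib del: of_real_power flip: of_real_mult)
  finally show ?thesis
    by (metis mult_nonneg_nonneg norm_ge_zero of_real_eq_iff power2_eq_imp_eq)
qed

text \<open>Multiplying \<open>x\<close> by a unimodular \<open>u\<close> makes the complex inner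
  product real and nonnegative, so that it equals the real inner product of
  \<open>u *\<^sub>C x\<close> and \<open>y\<close>, where the real Cauchy-Schwarz inequality
  applies.\<close>

lemma norm_cinner_le: "cmod (cinner x y) \<le> norm x * norm y"
proof (cases "cinner x y = 0")
  case False
  define u where "u = cnj (cinner x y) / cmod (cinner x y)"
  have "u * cinner x y = cmod (cinner x y)"
    using False by (simp add: u_def mult.commute[of "cnj _"] complex_norm_square[symmetric]
        power2_eq_square)
  then have "cmod (cinner x y) = inner (u *\<^sub>C x) y"
    by (metis Re_cinner Re_complex_of_real cinner_scaleC_left)
  also have "\<dots> \<le> norm (u *\<^sub>C x) * norm y"
    by (rule norm_cauchy_schwarz)
  also have "norm (u *\<^sub>C x) = norm x"
    using False by (simp add: norm_scaleC u_def norm_divide)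
  finally show ?thesis .
qed simp

lemma bounded_linear_cinner_left: "bounded_linear (\<lambda>x. cinner x y)"
  by (rule bounded_linear_intro[where K = "norm y"])
    (auto simp: cinner_add_left cinner_scaleR_left norm_cinner_le)

lemma bounded_linear_cinner_right: "bounded_linear (\<lambda>y. cinner x y)"
  by (rule bounded_linear_intro[where K = "norm x"])
    (use norm_cinner_le[of x] in \<open>auto simp: cinner_add_right cinner_scaleR_right mult.commute\<close>)

lemma bounded_linear_scaleC_right: "bounded_linear (\<lambda>x. c *\<^sub>C x)"
  by (rule bounded_linear_intro[where K = "cmod c"])
    (auto simp: scaleC_add_right norm_scaleC scaleC_scaleR_commute mult.commute)

lemmas cinner_diff_left = linear_diff[OF bounded_linear.linear[OF bounded_linear_cinner_left]]
  and cinner_diff_right = linear_diff[OF bounded_linear.linear[OF bounded_linear_cinner_right]]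
  and cinner_minus_left = linear_neg[OF bounded_linear.linear[OF bounded_linear_cinner_left]]
  and cinner_zero_left [simp] = linear_0[OF bounded_linear.linear[OF bounded_linear_cinner_left]]
  and cinner_zero_right [simp] = linear_0[OF bounded_linear.linear[OF bounded_linear_cinner_right]]
  and cinner_sum_left = linear_sum[OF bounded_linear.linear[OF bounded_linear_cinner_left]]

lemma cinner_eqI:
  assumes "\<And>z. cinner x z = cinner y z"
  shows "x = y"
proof -
  have "cinner (x - y) (x - y) = 0"
    using assms by (simp add: cinner_diff_left)
  then show ?thesis
    by (simp add: cinner_self)
qed

section \<open>Bounded complex-linear operators\<close>

lemma bounded_clinearI:
  assumes "\<And>x y. A (x + y) = A x + A y" and "\<And>c x. A (c *\<^sub>C x) = c *\<^sub>C A x"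
    and "\<And>x. norm (A x) \<le> K * norm x"
  shows "bounded_clinear A"
proof -
  have "A (r *\<^sub>R x) = r *\<^sub>R A x" for r x
    using assms(2)[of "complex_of_real r" x] by (simp add: scaleC_of_real)
  then show ?thesis
    unfolding bounded_clinear_def
    using assms by (auto intro!: bounded_linear_intro[where K = K] simp: mult.commute)
qed

lemma bounded_clinear_bounded_linear: "bounded_clinear A \<Longrightarrow> bounded_linear A"
  by (simp add: bounded_clinear_def)

lemmas bounded_clinear_add = linear_add[OF bounded_linear.linear[OF bounded_clinear_bounded_linear]]
  and bounded_clinear_diff = linear_diff[OF bounded_linear.linear[OF bounded_clinear_bounded_linear]]
  and bounded_clinear_minus = linear_neg[OF bounded_linear.linear[OF bounded_clinear_bounded_linear]]
  and bounded_clinear_zero = linear_0[OF bounded_linear.linear[OF bounded_clinear_bounded_linear]]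
  and bounded_clinear_scaleR = linear_scale[OF bounded_linear.linear[OF bounded_clinear_bounded_linear]]

lemma bounded_clinear_scaleC: "bounded_clinear A \<Longrightarrow> A (c *\<^sub>C x) = c *\<^sub>C A x"
  by (simp add: bounded_clinear_def)

lemma bounded_clinear_sub:
  assumes "bounded_clinear A" "bounded_clinear B"
  shows "bounded_clinear (\<lambda>x. A x - B x)"
  using assms bounded_linear_sub unfolding bounded_clinear_def
  by (auto simp: complex_vector.scale_right_diff_distrib)

lemma bounded_clinear_uminus:
  assumes "bounded_clinear A"
  shows "bounded_clinear (\<lambda>x. - A x)"
  using assms bounded_linear_minus unfolding bounded_clinear_def by auto

lemma bounded_clinear_comp:
  assumes "bounded_clinear A" "bounded_clinear B"
  shows "bounded_clinear (A \<circ> B)"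
  using assms bounded_linear_compose[of A B] unfolding bounded_clinear_def
  by (auto simp: o_def)

lemma subspace_range:
  assumes "bounded_clinear A"
  shows "complex_vector.subspace (range A)"
  unfolding complex_vector.subspace_def
proof (intro conjI ballI allI)
  show "0 \<in> range A"
    by (metis assms bounded_clinear_zero rangeI)
  show "x + y \<in> range A" if "x \<in> range A" "y \<in> range A" for x y
    using that by (auto simp: bounded_clinear_add[OF assms, symmetric])
  show "c *\<^sub>C x \<in> range A" if "x \<in> range A" for c x
    using that by (auto simp: bounded_clinear_scaleC[OF assms, symmetric])
qed

lemma separable_dense_sequence:
  assumes "separable_space (euclidean :: 'a::metric_space topology)"
  obtains h :: "nat \<Rightarrow> 'a::metric_space" where "\<And>x e. 0 < e \<Longrightarrow> \<exists>n. dist (h n) x < e"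
proof -
  obtain C :: "'a set" where C: "countable C" "closure C = UNIV"
    using assms unfolding separable_space_def by auto
  \<comment> \<open>An enumeration of \<open>C\<close> by all natural numbers, with repetitions if
    \<open>C\<close> is finite, requires \<open>C\<close> to be nonempty.\<close>
  then have "C \<noteq> {}" by auto
  then have "range (from_nat_into C) = C"
    using C(1) by (rule range_from_nat_into)
  then have "\<exists>n. dist (from_nat_into C n) x < e" if "0 < e" for x e
    using C(2) that closure_approachable[of x C] by (metis UNIV_I imageE)
  then show thesis by (rule that)
qed

section \<open>Positive operators\<close>

text \<open>Taking the definite inner product for \<open>ip\<close> in \<open>J_positive\<close>
  gives ordinary Hilbert space positivity.\<close>

abbreviation positive_operator :: "('a::complex_hilbert_space \<Rightarrow> 'a) \<Rightarrow> bool"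
  where "positive_operator \<equiv> J_positive cinner"

lemma positive_operator_Re: "positive_operator A \<Longrightarrow> 0 \<le> Re (cinner (A x) x)"
  and positive_operator_Im: "positive_operator A \<Longrightarrow> Im (cinner (A x) x) = 0"
  by (auto simp: J_positive_def complex_nonneg_Reals_iff)

lemma positive_operator_clinear: "positive_operator A \<Longrightarrow> bounded_clinear A"
  by (simp add: J_positive_def)

text \<open>Polarization over the complex numbers: with \<open>a\<close> and \<open>b\<close> as in
  the proof, reality of the form at \<open>x + y\<close> gives \<open>Im a = - Im b\<close>, and at
  \<open>x + \<i> *\<^sub>C y\<close> it gives \<open>Re a = Re b\<close>.\<close>

lemma positive_operator_hermitian:
  assumes "positive_operator A"
  shows "cinner (A x) y = cinner x (A y)"
proof -
  note lin = positive_operator_clinear[OF assms]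
  define a b where "a = cinner (A x) y" and "b = cinner (A y) x"
  have "cinner (A (x + y)) (x + y) = cinner (A x) x + a + b + cinner (A y) y"
    by (simp add: bounded_clinear_add[OF lin] cinner_add_left cinner_add_right a_def b_def)
  then have "Im (a + b) = 0"
    using positive_operator_Im[OF assms, of "x + y"] positive_operator_Im[OF assms, of x]
      positive_operator_Im[OF assms, of y] by simp
  moreover have "cinner (A (x + \<i> *\<^sub>C y)) (x + \<i> *\<^sub>C y)
      = cinner (A x) x - \<i> * a + \<i> * b + cinner (A y) y"
    by (simp add: bounded_clinear_add[OF lin] bounded_clinear_scaleC[OF lin] cinner_add_left
        cinner_add_right cinner_scaleC_left cinner_scaleC_right a_def b_def algebra_simps)
  then have "Im (cinner (A x) x - \<i> * a + \<i> * b + cinner (A y) y) = 0"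
    using positive_operator_Im[OF assms, of "x + \<i> *\<^sub>C y"] by simp
  ultimately have "a = cnj b"
    using positive_operator_Im[OF assms, of x] positive_operator_Im[OF assms, of y]
    by (simp add: complex_eq_iff)
  then show ?thesis
    unfolding a_def b_def by (metis cinner_commute)
qed

text \<open>The form at \<open>x - (t * a) *\<^sub>C y\<close> is a nonnegative polynomial in the
  real variable \<open>t\<close>. The form is only semidefinite, so its leading coefficient may
  vanish and two cases arise.\<close>

lemma positive_operator_Cauchy_Schwarz:
  assumes "positive_operator A"
  shows "(cmod (cinner (A x) y))\<^sup>2 \<le> Re (cinner (A x) x) * Re (cinner (A y) y)"
proof -
  note lin = positive_operator_clinear[OF assms]
  define a p q where "a = cinner (A x) y" and "p = Re (cinner (A x) x)" and "q = Re (cinner (A y) y)"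
  have *: "cinner (A y) x = cnj a"
    unfolding a_def by (metis assms cinner_commute positive_operator_hermitian)
  have "0 \<le> p - 2 * t * (cmod a)\<^sup>2 + t\<^sup>2 * (cmod a)\<^sup>2 * q" for t
  proof -
    have "cinner (A (x - (t * a) *\<^sub>C y)) (x - (t * a) *\<^sub>C y)
        = cinner (A x) x - t * (a * cnj a) - t * (a * cnj a) + t\<^sup>2 * (a * cnj a) * cinner (A y) y"
      by (simp add: bounded_clinear_diff[OF lin] bounded_clinear_scaleC[OF lin] cinner_diff_left
          cinner_diff_right cinner_scaleC_left cinner_scaleC_right * a_def[symmetric] algebra_simps
          power2_eq_square)
    also have "a * cnj a = complex_of_real ((cmod a)\<^sup>2)"
      by (simp only: complex_norm_square)
    finally show ?thesis
      using positive_operator_Re[OF assms, of "x - (t * a) *\<^sub>C y"]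
      by (simp add: p_def q_def flip: of_real_power)
  qed
  note t = this
  show ?thesis
  proof (cases "q = 0")
    case True
    have "(cmod a)\<^sup>2 \<le> 0"
    proof (rule ccontr)
      assume "\<not> (cmod a)\<^sup>2 \<le> 0"
      then show False
        \<comment> \<open>For \<open>q = 0\<close> the polynomial is affine in \<open>t\<close>, and
          this \<open>t\<close> gives it the negative value \<open>- p - 2\<close>.\<close>
        using t[of "(p + 1) / (cmod a)\<^sup>2"] True positive_operator_Re[OF assms, of x]
        by (simp add: p_def)
    qed
    then show ?thesis using True by (simp add: a_def q_def)
  next
    case False
    then have "0 < q"
      using positive_operator_Re[OF assms, of y] by (simp add: q_def)
    then show ?thesis
      \<comment> \<open>The polynomial attains its minimum at \<open>t = 1 / q\<close>.\<close>
      using t[of "1 / q"] by (simp add: a_def[symmetric] p_def[symmetric] q_def[symmetric]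
          field_simps power2_eq_square)
  qed
qed

text \<open>If \<open>cinner (A u) u = 0\<close> then division by zero makes the pivot \<open>0\<close>; in that case \<open>A u = 0\<close>.\<close>

definition pivot :: "('a::complex_hilbert_space \<Rightarrow> 'a) \<Rightarrow> 'a \<Rightarrow> 'a"
  where "pivot A u = (1 / sqrt (Re (cinner (A u) u))) *\<^sub>R A u"

text \<open>The normalization of the pivot makes this the Schur complement of \<open>A\<close> with
  respect to \<open>u\<close>: the subtracted operator sends \<open>x\<close> to
  \<open>cinner x (A u) / cinner (A u) u\<close> times \<open>A u\<close>.\<close>

definition deflate :: "('a::complex_hilbert_space \<Rightarrow> 'a) \<Rightarrow> 'a \<Rightarrow> 'a \<Rightarrow> 'a"
  where "deflate A u x = A x - cinner x (pivot A u) *\<^sub>C pivot A u"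

lemma cinner_deflate:
  "cinner (deflate A u x) x = cinner (A x) x - complex_of_real ((cmod (cinner x (pivot A u)))\<^sup>2)"
  unfolding deflate_def cinner_diff_left cinner_scaleC_left complex_norm_square
  by (metis cinner_commute)

lemma cinner_pivot:
  assumes "positive_operator A"
  shows "cinner x (pivot A u) = (1 / sqrt (Re (cinner (A u) u))) *\<^sub>R cinner (A x) u"
  by (simp add: pivot_def cinner_scaleR_right positive_operator_hermitian[OF assms])

text \<open>Cauchy-Schwarz for the form of \<open>A\<close>, divided by
  \<open>cinner (A u) u\<close>. By \<open>cinner_deflate\<close> this is precisely what keeps the
  form of the deflated operator nonnegative.\<close>

lemma cmod_cinner_pivot_le:
  assumes "positive_operator A"
  shows "(cmod (cinner x (pivot A u)))\<^sup>2 \<le> Re (cinner (A x) x)"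
proof (cases "Re (cinner (A u) u) = 0")
  case True
  then show ?thesis
    using positive_operator_Re[OF assms, of x] by (simp add: pivot_def)
next
  case False
  then have "0 < Re (cinner (A u) u)"
    using positive_operator_Re[OF assms, of u] by simp
  then show ?thesis
    using positive_operator_Cauchy_Schwarz[OF assms, of x u]
    by (simp add: cinner_pivot[OF assms] power_divide norm_divide divide_le_eq)
qed

lemma positive_operator_deflate:
  assumes "positive_operator A"
  shows "positive_operator (deflate A u)"
  unfolding J_positive_def
proof
  have "norm (cinner x p *\<^sub>C p) \<le> (norm p * norm p) * norm x" for x p :: 'a
    using mult_right_mono[OF norm_cinner_le, of "norm p" x p] by (simp add: norm_scaleC mult_ac)
  then have "bounded_clinear (\<lambda>x. cinner x (pivot A u) *\<^sub>C pivot A u)"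
    by (intro bounded_clinearI[where K = "norm (pivot A u) * norm (pivot A u)"])
      (auto simp: cinner_add_left scaleC_add_left cinner_scaleC_left)
  then show "bounded_clinear (deflate A u)"
    using bounded_clinear_sub[OF positive_operator_clinear[OF assms]]
    unfolding deflate_def by blast
  show "\<forall>x. cinner (deflate A u x) x \<in> \<real>\<^sub>\<ge>\<^sub>0"
    using cmod_cinner_pivot_le[OF assms] positive_operator_Im[OF assms]
    by (auto simp: complex_nonneg_Reals_iff cinner_deflate)
qed

lemma deflate_pivot:
  assumes "positive_operator A"
  shows "deflate A u u = 0"
proof (cases "Re (cinner (A u) u) = 0")
  case True
  \<comment> \<open>In the degenerate case, Cauchy-Schwarz for the pair \<open>u\<close>,
    \<open>A u\<close> has the factor \<open>cinner (A u) u = 0\<close> on its right-hand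
    side.\<close>
  then have "cmod (cinner (A u) (A u)) = 0"
    using positive_operator_Cauchy_Schwarz[OF assms, of u "A u"] by simp
  then have "A u = 0"
    by (simp add: cinner_self)
  then show ?thesis
    by (simp add: deflate_def pivot_def)
next
  case False
  define q where "q = Re (cinner (A u) u)"
  have q: "0 < q" "cinner (A u) u = complex_of_real q"
    using False positive_operator_Re[OF assms, of u] positive_operator_Im[OF assms, of u]
    by (auto simp: q_def complex_eq_iff)
  have "cinner u (pivot A u) = complex_of_real (q / sqrt q)"
    by (simp add: cinner_pivot[OF assms] q(2) scaleR_conv_of_real)
  then have "cinner u (pivot A u) *\<^sub>C pivot A u = (q / sqrt q * (1 / sqrt q)) *\<^sub>R A u"
    by (simp add: scaleC_of_real pivot_def q(2) del: of_real_divide)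
  also have "\<dots> = A u"
    using q(1) by (simp add: real_sqrt_mult_self)
  finally show ?thesis
    by (simp add: deflate_def)
qed

text \<open>Because \<open>A\<close> is Hermitian, \<open>cinner x (pivot A u)\<close> is a multiple
  of \<open>cinner (A x) u\<close>; hence the kernel of \<open>A\<close> is orthogonal to the pivot
  and survives the step.\<close>

lemma deflate_eq_0:
  assumes "positive_operator A" "A x = 0"
  shows "deflate A u x = 0"
  by (simp add: deflate_def cinner_pivot assms)

text \<open>
  Symmetric Gaussian elimination: each step subtracts the rank-one operator of a pivot and stays
  positive by the Cauchy-Schwarz inequality for \<open>A\<close>. Once \<open>h n\<close> has been used as a pivot it is in
  the kernel of all later residuals, so for a dense sequence \<open>h\<close> the residuals tend strongly to \<open>0\<close>.
\<close>

primrec residual :: "('a::complex_hilbert_space \<Rightarrow> 'a) \<Rightarrow> (nat \<Rightarrow> 'a) \<Rightarrow> nat \<Rightarrow> 'a \<Rightarrow> 'a"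
  where "residual A h 0 = A"
  | "residual A h (Suc n) = deflate (residual A h n) (h n)"

lemma positive_operator_residual:
  "positive_operator A \<Longrightarrow> positive_operator (residual A h n)"
  by (induction n) (auto intro: positive_operator_deflate)

text \<open>Step \<open>Suc n\<close> puts \<open>h n\<close> into the kernel by
  \<open>deflate_pivot\<close>, and every later step keeps it there by
  \<open>deflate_eq_0\<close>.\<close>

lemma residual_eq_0:
  assumes "positive_operator A" "n < m"
  shows "residual A h m (h n) = 0"
  using assms(2)
proof (induction m)
  case (Suc m)
  then show ?case
    using deflate_pivot[OF positive_operator_residual[OF assms(1), of h m]]
      deflate_eq_0[OF positive_operator_residual[OF assms(1), of h m]]
    by (cases "n = m") auto
qed simp

lemma residual_sum:
  "A x = residual A h n x +
    (\<Sum>k<n. cinner x (pivot (residual A h k) (h k)) *\<^sub>C pivot (residual A h k) (h k))"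
  by (induction n) (auto simp: deflate_def algebra_simps)

text \<open>Both terms on the right are nonnegative, so this one identity bounds the residual form
  by that of \<open>A\<close> and also yields the Bessel inequality for the pivots.\<close>

lemma cinner_residual_sum:
  "Re (cinner (A x) x) = Re (cinner (residual A h n x) x) +
    (\<Sum>k<n. (cmod (cinner x (pivot (residual A h k) (h k))))\<^sup>2)"
  by (induction n) (auto simp: cinner_deflate)

text \<open>Cauchy-Schwarz for \<open>B\<close> at the pair \<open>x\<close>, \<open>B x\<close>
  turns the comparison of quadratic forms into one of norms. The constant \<open>K\<close> is
  preserved, so a whole sequence of residuals shares it.\<close>

lemma positive_operator_bound:
  assumes "positive_operator A" "positive_operator B"
    and le: "\<And>x. Re (cinner (B x) x) \<le> Re (cinner (A x) x)"
    and K: "\<And>x. norm (A x) \<le> K * norm x"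
  shows "norm (B x) \<le> K * norm x"
proof -
  have *: "Re (cinner (B x) x) \<le> K * (norm x)\<^sup>2" for x
  proof -
    have "Re (cinner (A x) x) \<le> norm (A x) * norm x"
      using complex_Re_le_cmod norm_cinner_le order_trans by blast
    also have "\<dots> \<le> K * (norm x)\<^sup>2"
      using mult_right_mono[OF K, of "norm x" x] by (simp add: power2_eq_square mult.assoc)
    finally show ?thesis using le[of x] by linarith
  qed
  show ?thesis
  proof (cases "B x = 0")
    case True
    have "0 \<le> norm (A x)" by simp
    then show ?thesis using True K[of x] by (metis norm_zero order_trans)
  next
    case False
    have "((norm (B x))\<^sup>2)\<^sup>2 = (cmod (cinner (B x) (B x)))\<^sup>2"
      by (simp add: cinner_self norm_power)
    also have "\<dots> \<le> Re (cinner (B x) x) * Re (cinner (B (B x)) (B x))"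
      by (rule positive_operator_Cauchy_Schwarz[OF assms(2)])
    also have "\<dots> \<le> (K * (norm x)\<^sup>2) * (K * (norm (B x))\<^sup>2)"
      using * positive_operator_Re[OF assms(2)] by (intro mult_mono) (auto intro: order_trans)
    finally have "(norm (B x))\<^sup>2 * (norm (B x))\<^sup>2 \<le> (K * norm x)\<^sup>2 * (norm (B x))\<^sup>2"
      by (simp add: power2_eq_square mult_ac)
    from mult_right_le_imp_le[OF this] have "(norm (B x))\<^sup>2 \<le> (K * norm x)\<^sup>2"
      using False by simp
    moreover have "0 \<le> K * norm x"
      using K[of x] norm_ge_zero[of "A x"] by linarith
    ultimately show ?thesis
      by (rule power2_le_imp_le)
  qed
qed

lemma bounded_clinear_bound:
  assumes "bounded_clinear A"
  obtains K where "0 < K" "\<And>x. norm (A x) \<le> K * norm x"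
  using bounded_linear.pos_bounded[OF bounded_clinear_bounded_linear[OF assms]]
  by (metis mult.commute)

text \<open>The residuals have the common norm bound \<open>K\<close>. If \<open>h n\<close> is
  within \<open>e / K\<close> of \<open>x\<close>, every residual after step \<open>n\<close> kills
  \<open>h n\<close> and therefore has norm below \<open>e\<close> at \<open>x\<close>.\<close>

lemma residual_tendsto_0:
  assumes A: "positive_operator A"
    and dense: "\<And>x e. 0 < e \<Longrightarrow> \<exists>n. dist (h n) x < e"
  shows "(\<lambda>m. residual A h m x) \<longlonglongrightarrow> 0"
proof (rule LIMSEQ_I)
  fix e :: real assume "0 < e"
  obtain K where K: "0 < K" "\<And>x. norm (A x) \<le> K * norm x"
    using bounded_clinear_bound[OF positive_operator_clinear[OF A]] by blast
  have bound: "norm (residual A h m x) \<le> K * norm x" for m x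
  proof (rule positive_operator_bound[OF A positive_operator_residual[OF A] _ K(2)])
    show "Re (cinner (residual A h m x) x) \<le> Re (cinner (A x) x)" for x
      unfolding cinner_residual_sum[of A x h m] by (simp add: sum_nonneg)
  qed
  obtain n where n: "dist (h n) x < e / K"
    using dense \<open>0 < e\<close> K(1) by (meson divide_pos_pos)
  have "norm (residual A h m x) < e" if "n < m" for m
  proof -
    have "residual A h m x = residual A h m (x - h n)"
      using residual_eq_0[OF A that]
      by (simp add: bounded_clinear_diff[OF positive_operator_clinear[OF positive_operator_residual[OF A]]])
    also have "norm \<dots> \<le> K * dist (h n) x"
      using bound by (metis dist_norm norm_minus_commute)
    also have "\<dots> < e"
      using n K(1) by (simp add: field_simps)
    finally show ?thesis .
  qed
  then show "\<exists>no. \<forall>m\<ge>no. norm (residual A h m x - 0) < e"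
    by (intro exI[of _ "Suc n"]) auto
qed

section \<open>Bessel families and their synthesis operators\<close>

text \<open>Finite partial sums and an explicit nonnegative constant avoid summability conditions
  and pass directly to subsets of \<open>I\<close>.\<close>

definition Bessel_bound :: "'i set \<Rightarrow> ('i \<Rightarrow> 'a::complex_hilbert_space) \<Rightarrow> real \<Rightarrow> bool"
  where "Bessel_bound I f B \<longleftrightarrow> 0 \<le> B \<and>
    (\<forall>h F. finite F \<longrightarrow> F \<subseteq> I \<longrightarrow> (\<Sum>i\<in>F. (cmod (cinner h (f i)))\<^sup>2) \<le> B * (norm h)\<^sup>2)"

lemma Bessel_boundD:
  "Bessel_bound I f B \<Longrightarrow> finite F \<Longrightarrow> F \<subseteq> I \<Longrightarrow> (\<Sum>i\<in>F. (cmod (cinner h (f i)))\<^sup>2) \<le> B * (norm h)\<^sup>2"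
  by (simp add: Bessel_bound_def)

lemma Bessel_bound_nonneg: "Bessel_bound I f B \<Longrightarrow> 0 \<le> B"
  by (simp add: Bessel_bound_def)

lemma Bessel_bound_subset: "Bessel_bound I f B \<Longrightarrow> K \<subseteq> I \<Longrightarrow> Bessel_bound K f B"
  unfolding Bessel_bound_def by (meson order_trans)

lemma Bessel_family_bound:
  assumes "Bessel_family I f"
  obtains B where "Bessel_bound I f B"
proof -
  obtain B where B: "(\<lambda>i. (cmod (cinner h (f i)))\<^sup>2) summable_on I"
      "(\<Sum>\<^sub>\<infinity>i\<in>I. (cmod (cinner h (f i)))\<^sup>2) \<le> B * (norm h)\<^sup>2" for h
    using assms unfolding Bessel_family_def by blast
  \<comment> \<open>In the zero space the constant supplied by \<open>Bessel_family\<close> may be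
    negative, hence the maximum with 0.\<close>
  have "(\<Sum>i\<in>F. (cmod (cinner h (f i)))\<^sup>2) \<le> max B 0 * (norm h)\<^sup>2" if "finite F" "F \<subseteq> I" for h F
  proof -
    have "(\<Sum>i\<in>F. (cmod (cinner h (f i)))\<^sup>2) \<le> (\<Sum>\<^sub>\<infinity>i\<in>I. (cmod (cinner h (f i)))\<^sup>2)"
      by (rule finite_sum_le_infsum[OF B(1)]) (use that in auto)
    also have "\<dots> \<le> B * (norm h)\<^sup>2"
      by (rule B(2))
    also have "\<dots> \<le> max B 0 * (norm h)\<^sup>2"
      by (rule mult_right_mono) auto
    finally show ?thesis .
  qed
  then have "Bessel_bound I f (max B 0)"
    by (simp add: Bessel_bound_def)
  then show thesis by (rule that)
qed

lemma Bessel_bound_summable: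
  assumes "Bessel_bound I f B"
  shows "(\<lambda>i. (cmod (cinner h (f i)))\<^sup>2) summable_on I"
  by (rule nonneg_bounded_partial_sums_imp_summable_on[where C = "B * (norm h)\<^sup>2"])
    (auto intro!: eventually_finite_subsets_at_top_weakI Bessel_boundD[OF assms])

lemma Bessel_bound_infsum_le:
  assumes "Bessel_bound I f B"
  shows "(\<Sum>\<^sub>\<infinity>i\<in>I. (cmod (cinner h (f i)))\<^sup>2) \<le> B * (norm h)\<^sup>2"
  by (rule infsum_le_finite_sums[OF Bessel_bound_summable[OF assms]])
    (rule Bessel_boundD[OF assms])

lemma Bessel_bound_family: "Bessel_bound I f B \<Longrightarrow> Bessel_family I f"
  unfolding Bessel_family_def using Bessel_bound_summable Bessel_bound_infsum_le by blast

text \<open>Duality: expand the squared norm of the sum \<open>z\<close> as the sum of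
  \<open>x i * cinner (f i) z\<close>, apply Cauchy-Schwarz to finite sums and the Bessel inequality
  at \<open>z\<close>, then cancel a factor \<open>(norm z)\<^sup>2\<close>.\<close>

lemma Bessel_norm_sum_le:
  assumes "Bessel_bound I f B" "finite F" "F \<subseteq> I"
  shows "(norm (\<Sum>i\<in>F. x i *\<^sub>C f i))\<^sup>2 \<le> B * (\<Sum>i\<in>F. (cmod (x i))\<^sup>2)"
proof -
  define z where "z = (\<Sum>i\<in>F. x i *\<^sub>C f i)"
  define s where "s = (\<Sum>i\<in>F. (cmod (x i))\<^sup>2)"
  have "(norm z)\<^sup>2 = cmod (\<Sum>i\<in>F. x i * cinner (f i) z)"
    using cinner_self[of z] unfolding z_def
    by (metis (no_types, lifting) cinner_scaleC_left cinner_sum_left norm_of_real abs_of_nonneg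
        sum.cong zero_le_power2)
  also have "\<dots> \<le> (\<Sum>i\<in>F. cmod (x i) * cmod (cinner z (f i)))"
    by (rule order_trans[OF norm_sum])
      (simp add: norm_mult cinner_commute[of z] complex_mod_cnj sum_mono)
  finally have "((norm z)\<^sup>2)\<^sup>2 \<le> (\<Sum>i\<in>F. cmod (x i) * cmod (cinner z (f i)))\<^sup>2"
    by (rule power_mono) simp
  also have "\<dots> \<le> s * (\<Sum>i\<in>F. (cmod (cinner z (f i)))\<^sup>2)"
    unfolding s_def by (rule Cauchy_Schwarz_ineq_sum)
  also have "\<dots> \<le> s * (B * (norm z)\<^sup>2)"
    by (rule mult_left_mono[OF Bessel_boundD[OF assms]]) (simp add: s_def sum_nonneg)
  finally have *: "(norm z)\<^sup>2 * (norm z)\<^sup>2 \<le> (B * s) * (norm z)\<^sup>2"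
    by (simp add: power2_eq_square mult_ac)
  show ?thesis
  proof (cases "z = 0")
    case True
    have "0 \<le> B * s"
      using Bessel_bound_nonneg[OF assms(1)] by (simp add: s_def sum_nonneg)
    then show ?thesis using True unfolding z_def s_def by simp
  next
    case False
    then have "(norm z)\<^sup>2 \<le> B * s"
      using mult_right_le_imp_le[OF *] by simp
    then show ?thesis unfolding z_def s_def .
  qed
qed

text \<open>The net of finite partial sums is Cauchy: beyond a suitable finite set, their
  differences are controlled by tails of the convergent sum of \<open>(cmod (x i))\<^sup>2\<close>.
  The sum is thus unconditional, over an arbitrary index set.\<close>

lemma Bessel_summable:
  fixes f :: "'i \<Rightarrow> 'a::complex_hilbert_space"
  assumes B: "Bessel_bound I f B" and x: "(\<lambda>i. (cmod (x i))\<^sup>2) summable_on I"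
  shows "(\<lambda>i. x i *\<^sub>C f i) summable_on I"
proof -
  define S where "S F = (\<Sum>i\<in>F. x i *\<^sub>C f i)" for F
  define N where "N F = (\<Sum>i\<in>F. (cmod (x i))\<^sup>2)" for F
  obtain s where "((\<lambda>i. (cmod (x i))\<^sup>2) has_sum s) I"
    using x unfolding summable_on_def ..
  then have s: "(N \<longlongrightarrow> s) (finite_subsets_at_top I)"
    unfolding has_sum_def N_def .
  have "\<exists>P. eventually P (finite_subsets_at_top I) \<and> (\<forall>F G. P F \<and> P G \<longrightarrow> dist (S F) (S G) < e)"
    if "0 < e" for e
  proof -
    \<comment> \<open>The denominator \<open>B + 1\<close> instead of \<open>B\<close> covers
      \<open>B = 0\<close> and leaves the strict inequality
      \<open>B * d < (e / 2)\<^sup>2\<close>.\<close>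
    define d where "d = (e / 2)\<^sup>2 / (B + 1)"
    have "0 < d"
      using \<open>0 < e\<close> Bessel_bound_nonneg[OF B] by (simp add: d_def)
    then have "\<forall>\<^sub>F F in finite_subsets_at_top I. dist (N F) s < d / 2"
      using tendstoD[OF s, of "d / 2"] by simp
    then obtain X where X: "finite X" "X \<subseteq> I"
      and near: "\<And>F. finite F \<Longrightarrow> X \<subseteq> F \<Longrightarrow> F \<subseteq> I \<Longrightarrow> dist (N F) s < d / 2"
      unfolding eventually_finite_subsets_at_top by metis
    have close: "dist (S F) (S X) < e / 2" if F: "finite F" "X \<subseteq> F" "F \<subseteq> I" for F
    proof -
      have "N (F - X) = N F - N X"
        unfolding N_def using F by (simp add: sum_diff)
      also have "\<dots> < d"
        using near[OF F] near[OF X(1) order_refl X(2)] unfolding dist_real_def by linarith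
      finally have "B * N (F - X) \<le> B * d"
        using Bessel_bound_nonneg[OF B] by (simp add: mult_left_mono)
      moreover have "(norm (S (F - X)))\<^sup>2 \<le> B * N (F - X)"
        unfolding S_def N_def by (rule Bessel_norm_sum_le[OF B]) (use F in auto)
      moreover have "B * d < (B + 1) * d"
        using \<open>0 < d\<close> by simp
      moreover have "(B + 1) * d = (e / 2)\<^sup>2"
        using Bessel_bound_nonneg[OF B] by (simp add: d_def)
      ultimately have "(norm (S (F - X)))\<^sup>2 < (e / 2)\<^sup>2"
        by linarith
      then have "norm (S (F - X)) < e / 2"
        by (rule power2_less_imp_less) (use \<open>0 < e\<close> in simp)
      moreover have "S (F - X) = S F - S X"
        unfolding S_def using F by (simp add: sum_diff)
      ultimately show ?thesis
        by (simp add: dist_norm)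
    qed
    define P where "P F \<longleftrightarrow> finite F \<and> X \<subseteq> F \<and> F \<subseteq> I" for F
    have "eventually P (finite_subsets_at_top I)"
      unfolding P_def eventually_finite_subsets_at_top using X by auto
    moreover have "dist (S F) (S G) < e" if "P F \<and> P G" for F G
      using dist_triangle2[of "S F" "S G" "S X"] close[of F] close[of G] that by (simp add: P_def)
    ultimately show ?thesis by blast
  qed
  then have "cauchy_filter (filtermap S (finite_subsets_at_top I))"
    by (simp add: cauchy_filter_metric_filtermap)
  moreover have "complete (UNIV :: 'a set)"
    by (meson Cauchy_convergent UNIV_I complete_def convergent_def)
  ultimately obtain L where "(S \<longlongrightarrow> L) (finite_subsets_at_top I)"
    using complete_uniform[where S = UNIV] by (force simp add: filterlim_def)
  then show ?thesis
    unfolding summable_on_def has_sum_def S_def by blast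
qed

lemma Bessel_norm_has_sum_le:
  assumes B: "Bessel_bound I f B" and x: "(\<lambda>i. (cmod (x i))\<^sup>2) summable_on I"
    and z: "((\<lambda>i. x i *\<^sub>C f i) has_sum z) I"
  shows "(norm z)\<^sup>2 \<le> B * (\<Sum>\<^sub>\<infinity>i\<in>I. (cmod (x i))\<^sup>2)"
proof (rule tendsto_upperbound)
  show "((\<lambda>F. (norm (\<Sum>i\<in>F. x i *\<^sub>C f i))\<^sup>2) \<longlongrightarrow> (norm z)\<^sup>2) (finite_subsets_at_top I)"
    using z unfolding has_sum_def by (intro tendsto_intros)
  show "\<forall>\<^sub>F F in finite_subsets_at_top I.
      (norm (\<Sum>i\<in>F. x i *\<^sub>C f i))\<^sup>2 \<le> B * (\<Sum>\<^sub>\<infinity>i\<in>I. (cmod (x i))\<^sup>2)"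
  proof (rule eventually_finite_subsets_at_top_weakI)
    fix F assume F: "finite F" "F \<subseteq> I"
    have "(\<Sum>i\<in>F. (cmod (x i))\<^sup>2) \<le> (\<Sum>\<^sub>\<infinity>i\<in>I. (cmod (x i))\<^sup>2)"
      by (rule finite_sum_le_infsum[OF x F]) simp
    then show "(norm (\<Sum>i\<in>F. x i *\<^sub>C f i))\<^sup>2 \<le> B * (\<Sum>\<^sub>\<infinity>i\<in>I. (cmod (x i))\<^sup>2)"
      using Bessel_norm_sum_le[OF B F, of x] mult_left_mono[OF _ Bessel_bound_nonneg[OF B]]
      by (meson order_trans)
  qed
qed simp

text \<open>This is the synthesis operator of the family over \<open>I\<close> composed with its
  adjoint. Below it is also taken over the positive or negative indices alone.\<close>

definition frame_operator :: "'i set \<Rightarrow> ('i \<Rightarrow> 'a::complex_hilbert_space) \<Rightarrow> 'a \<Rightarrow> 'a"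
  where "frame_operator I f h = (\<Sum>\<^sub>\<infinity>i\<in>I. cinner h (f i) *\<^sub>C f i)"

lemma frame_operator_has_sum:
  assumes "Bessel_bound I f B"
  shows "((\<lambda>i. cinner h (f i) *\<^sub>C f i) has_sum frame_operator I f h) I"
  unfolding frame_operator_def
  by (intro has_sum_infsum Bessel_summable[OF assms] Bessel_bound_summable[OF assms])

text \<open>The quadratic form is the sum of the squares
  \<open>(cmod (cinner x (f i)))\<^sup>2\<close>. The norm bound \<open>B\<close> results from using
  the Bessel inequality twice, once for the synthesis and once for the coefficients.\<close>

lemma positive_operator_frame_operator:
  fixes f :: "'i \<Rightarrow> 'a::complex_hilbert_space"
  assumes "Bessel_bound I f B"
  shows "positive_operator (frame_operator I f)"
  unfolding J_positive_def
proof
  note sum = frame_operator_has_sum[OF assms]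
  show "bounded_clinear (frame_operator I f)"
  proof (rule bounded_clinearI[where K = B])
    fix x y :: 'a and c :: complex
    show "frame_operator I f (x + y) = frame_operator I f x + frame_operator I f y"
      using sum[of "x + y"] has_sum_add[OF sum[of x] sum[of y]]
      by (auto simp: cinner_add_left scaleC_add_left dest: has_sum_unique)
    show "frame_operator I f (c *\<^sub>C x) = c *\<^sub>C frame_operator I f x"
      using sum[of "c *\<^sub>C x"] has_sum_bounded_linear[OF bounded_linear_scaleC_right sum[of x], of c]
      by (auto simp: cinner_scaleC_left dest: has_sum_unique)
    have "(norm (frame_operator I f x))\<^sup>2 \<le> B * (\<Sum>\<^sub>\<infinity>i\<in>I. (cmod (cinner x (f i)))\<^sup>2)"
      by (rule Bessel_norm_has_sum_le[OF assms Bessel_bound_summable[OF assms] sum])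
    also have "\<dots> \<le> B * (B * (norm x)\<^sup>2)"
      by (intro mult_left_mono Bessel_bound_infsum_le[OF assms] Bessel_bound_nonneg[OF assms])
    also have "\<dots> = (B * norm x)\<^sup>2"
      by (simp add: power2_eq_square)
    finally show "norm (frame_operator I f x) \<le> B * norm x"
      by (rule power2_le_imp_le) (use Bessel_bound_nonneg[OF assms] in simp)
  qed
  show "\<forall>x. cinner (frame_operator I f x) x \<in> \<real>\<^sub>\<ge>\<^sub>0"
  proof
    fix x
    define r where "r = (\<Sum>\<^sub>\<infinity>i\<in>I. (cmod (cinner x (f i)))\<^sup>2)"
    have "((\<lambda>i. (cmod (cinner x (f i)))\<^sup>2) has_sum r) I"
      unfolding r_def by (intro has_sum_infsum Bessel_bound_summable[OF assms])
    then have r: "((\<lambda>i. complex_of_real ((cmod (cinner x (f i)))\<^sup>2)) has_sum complex_of_real r) I"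
      by (rule has_sum_of_real)
    have "((\<lambda>i. cinner (cinner x (f i) *\<^sub>C f i) x) has_sum cinner (frame_operator I f x) x) I"
      by (rule has_sum_bounded_linear[OF bounded_linear_cinner_left sum])
    also have "(\<lambda>i. cinner (cinner x (f i) *\<^sub>C f i) x) = (\<lambda>i. complex_of_real ((cmod (cinner x (f i)))\<^sup>2))"
      unfolding cinner_scaleC_left complex_norm_square by (metis cinner_commute)
    finally have "cinner (frame_operator I f x) x = complex_of_real r"
      using r by (rule has_sum_unique)
    moreover have "0 \<le> r"
      unfolding r_def by (simp add: infsum_nonneg)
    ultimately show "cinner (frame_operator I f x) x \<in> \<real>\<^sub>\<ge>\<^sub>0"
      by simp
  qed
qed

section \<open>The space l2(I), synthesis and analysis\<close>

lemma ell2_add: "x \<in> ell2 I \<Longrightarrow> y \<in> ell2 I \<Longrightarrow> (\<lambda>i. x i + y i) \<in> ell2 I"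
proof -
  assume x: "x \<in> ell2 I" and y: "y \<in> ell2 I"
  have "(\<lambda>i. 2 * (cmod (x i))\<^sup>2 + 2 * (cmod (y i))\<^sup>2) summable_on I"
    using x y by (intro summable_on_add summable_on_cmult_right) (auto simp: ell2_def)
  then have "(\<lambda>i. (cmod (x i + y i))\<^sup>2) summable_on I"
  proof (rule summable_on_comparison_test)
    fix i
    have "(cmod (x i + y i))\<^sup>2 \<le> (cmod (x i) + cmod (y i))\<^sup>2"
      by (intro power_mono norm_triangle_ineq) simp
    also have "\<dots> \<le> 2 * (cmod (x i))\<^sup>2 + 2 * (cmod (y i))\<^sup>2"
      using sum_squares_bound[of "cmod (x i)" "cmod (y i)"] by (simp add: power2_sum)
    finally show "(cmod (x i + y i))\<^sup>2 \<le> 2 * (cmod (x i))\<^sup>2 + 2 * (cmod (y i))\<^sup>2" .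
  qed simp
  then show ?thesis
    using x y by (simp add: ell2_def)
qed

lemma ell2_scale: "x \<in> ell2 I \<Longrightarrow> (\<lambda>i. c * x i) \<in> ell2 I"
  by (auto simp: ell2_def norm_mult power_mult_distrib intro: summable_on_cmult_right)

lemma ell2_proj_mem:
  assumes "x \<in> ell2 I"
  shows "ell2_proj K x \<in> ell2 I"
proof -
  have "(\<lambda>i. (cmod (x i))\<^sup>2) summable_on I"
    using assms by (simp add: ell2_def)
  then have "(\<lambda>i. (cmod (ell2_proj K x i))\<^sup>2) summable_on I"
    by (rule summable_on_comparison_test) (auto simp: ell2_proj_def)
  then show ?thesis
    using assms by (simp add: ell2_def ell2_proj_def)
qed

lemma ell2_basis_mem:
  assumes "i \<in> I"
  shows "ell2_basis i \<in> ell2 I"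
proof -
  have "(\<lambda>j. (cmod (ell2_basis i j))\<^sup>2) summable_on I \<longleftrightarrow> (\<lambda>j. (cmod (ell2_basis i j))\<^sup>2) summable_on {i}"
    by (rule summable_on_cong_neutral) (use assms in \<open>auto simp: ell2_basis_def\<close>)
  then show ?thesis
    using assms by (auto simp: ell2_def ell2_basis_def)
qed

text \<open>The truncation error for a finite set of coordinates. The difference is written with the
  factor \<open>- 1\<close> to fit the additivity and homogeneity clauses of
  \<open>ell2_bounded_clinear\<close>.\<close>

lemma ell2_norm_minus_proj:
  assumes "x \<in> ell2 I" "finite F" "F \<subseteq> I"
  shows "ell2_norm I (\<lambda>i. x i + (- 1) * ell2_proj F x i)
    = sqrt ((\<Sum>\<^sub>\<infinity>i\<in>I. (cmod (x i))\<^sup>2) - (\<Sum>i\<in>F. (cmod (x i))\<^sup>2))"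
proof -
  have "((\<lambda>i. (cmod (x i))\<^sup>2) has_sum (\<Sum>\<^sub>\<infinity>i\<in>I. (cmod (x i))\<^sup>2)) I"
    using assms(1) by (intro has_sum_infsum) (simp add: ell2_def)
  moreover have "((\<lambda>i. (cmod (x i))\<^sup>2) has_sum (\<Sum>i\<in>F. (cmod (x i))\<^sup>2)) F"
    using assms(2) by (rule has_sum_finite)
  ultimately have "((\<lambda>i. (cmod (x i))\<^sup>2) has_sum
      (\<Sum>\<^sub>\<infinity>i\<in>I. (cmod (x i))\<^sup>2) - (\<Sum>i\<in>F. (cmod (x i))\<^sup>2)) (I - F)"
    using assms(3) by (rule has_sum_Diff)
  moreover have "((\<lambda>i. (cmod (x i))\<^sup>2) has_sum s) (I - F) \<longleftrightarrow>
      ((\<lambda>i. (cmod (x i + (- 1) * ell2_proj F x i))\<^sup>2) has_sum s) I" for s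
    by (rule has_sum_cong_neutral) (auto simp: ell2_proj_def)
  ultimately show ?thesis
    by (simp add: ell2_norm_def infsumI)
qed

text \<open>Linearity settles the truncations of \<open>x\<close> to finite sets, and boundedness
  makes the truncation errors tend to 0. All synthesis operators of a family therefore agree on
  \<open>ell2 I\<close>.\<close>

lemma synthesis_operator_has_sum:
  assumes T: "synthesis_operator I f T" and x: "x \<in> ell2 I"
  shows "((\<lambda>i. x i *\<^sub>C f i) has_sum T x) I"
proof -
  have add: "T (\<lambda>i. y i + z i) = T y + T z" if "y \<in> ell2 I" "z \<in> ell2 I" for y z
    using T that by (simp add: synthesis_operator_def ell2_bounded_clinear_def)
  have scale: "T (\<lambda>i. c * y i) = c *\<^sub>C T y" if "y \<in> ell2 I" for c y
    using T that by (simp add: synthesis_operator_def ell2_bounded_clinear_def)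
  obtain C where C: "norm (T y) \<le> C * ell2_norm I y" if "y \<in> ell2 I" for y
    using T unfolding synthesis_operator_def ell2_bounded_clinear_def by blast
  have sum: "T (ell2_proj F x) = (\<Sum>i\<in>F. x i *\<^sub>C f i)" if "finite F" "F \<subseteq> I" for F
    using that
  proof (induction F)
    case empty
    have "T (\<lambda>i. 0 * x i) = 0"
      using scale[OF x, of 0] by simp
    then show ?case by (simp add: ell2_proj_def)
  next
    case (insert i F)
    have "ell2_proj (insert i F) x = (\<lambda>j. x i * ell2_basis i j + ell2_proj F x j)"
      using insert.hyps by (auto simp: ell2_proj_def ell2_basis_def)
    then have "T (ell2_proj (insert i F) x) = x i *\<^sub>C T (ell2_basis i) + T (ell2_proj F x)"
      using insert.prems add[OF ell2_scale[OF ell2_basis_mem[of i I], of "x i"] ell2_proj_mem[OF x, of F]]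
        scale[OF ell2_basis_mem[of i I], of "x i"] by simp
    then show ?case
      using insert T by (simp add: synthesis_operator_def)
  qed
  define s where "s = (\<Sum>\<^sub>\<infinity>i\<in>I. (cmod (x i))\<^sup>2)"
  have "((\<lambda>i. (cmod (x i))\<^sup>2) has_sum s) I"
    unfolding s_def using x by (intro has_sum_infsum) (simp add: ell2_def)
  then have "((\<lambda>F. \<Sum>i\<in>F. (cmod (x i))\<^sup>2) \<longlongrightarrow> s) (finite_subsets_at_top I)"
    by (simp add: has_sum_def)
  then have "((\<lambda>F. C * sqrt (s - (\<Sum>i\<in>F. (cmod (x i))\<^sup>2))) \<longlongrightarrow> C * sqrt (s - s))
      (finite_subsets_at_top I)"
    by (intro tendsto_intros)
  then have lim: "((\<lambda>F. C * sqrt (s - (\<Sum>i\<in>F. (cmod (x i))\<^sup>2))) \<longlongrightarrow> 0) (finite_subsets_at_top I)"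
    by simp
  have "((\<lambda>F. (\<Sum>i\<in>F. x i *\<^sub>C f i) - T x) \<longlongrightarrow> 0) (finite_subsets_at_top I)"
  proof (rule Lim_null_comparison[OF _ lim], rule eventually_finite_subsets_at_top_weakI)
    fix F assume F: "finite F" "F \<subseteq> I"
    have "T (\<lambda>i. x i + (- 1) * ell2_proj F x i) = T x - (\<Sum>i\<in>F. x i *\<^sub>C f i)"
      using add[OF x ell2_scale[OF ell2_proj_mem[OF x, of F]], of "- 1"]
        scale[OF ell2_proj_mem[OF x, of F], of "- 1"]
      by (simp add: sum[OF F])
    then show "norm ((\<Sum>i\<in>F. x i *\<^sub>C f i) - T x) \<le> C * sqrt (s - (\<Sum>i\<in>F. (cmod (x i))\<^sup>2))"
      using C[OF ell2_add[OF x ell2_scale[OF ell2_proj_mem[OF x, of F]]], of "- 1"]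
      unfolding ell2_norm_minus_proj[OF x F] s_def by (simp add: norm_minus_commute)
  qed
  then show ?thesis
    unfolding has_sum_def by (simp add: LIM_zero_iff)
qed

lemma synthesis_operator_exists:
  assumes B: "Bessel_bound I f B"
  obtains T where "synthesis_operator I f T"
proof -
  define T where "T x = (\<Sum>\<^sub>\<infinity>i\<in>I. x i *\<^sub>C f i)" for x
  have T: "((\<lambda>i. x i *\<^sub>C f i) has_sum T x) I" if "x \<in> ell2 I" for x
    unfolding T_def using that by (intro has_sum_infsum Bessel_summable[OF B]) (simp add: ell2_def)
  have "synthesis_operator I f T"
    unfolding synthesis_operator_def ell2_bounded_clinear_def
  proof (intro conjI ballI allI exI[of _ "sqrt B"])
    fix x y assume x: "x \<in> ell2 I" and y: "y \<in> ell2 I"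
    show "T (\<lambda>i. x i + y i) = T x + T y"
      using T[OF ell2_add[OF x y]] has_sum_add[OF T[OF x] T[OF y]]
      by (auto simp: scaleC_add_left dest: has_sum_unique)
  next
    fix x c assume x: "x \<in> ell2 I"
    show "T (\<lambda>i. c * x i) = c *\<^sub>C T x"
      using T[OF ell2_scale[OF x, of c]] has_sum_bounded_linear[OF bounded_linear_scaleC_right T[OF x], of c]
      by (auto dest: has_sum_unique)
  next
    fix x assume x: "x \<in> ell2 I"
    have "(norm (T x))\<^sup>2 \<le> B * (\<Sum>\<^sub>\<infinity>i\<in>I. (cmod (x i))\<^sup>2)"
      by (rule Bessel_norm_has_sum_le[OF B _ T[OF x]]) (use x in \<open>simp add: ell2_def\<close>)
    then have "sqrt ((norm (T x))\<^sup>2) \<le> sqrt (B * (\<Sum>\<^sub>\<infinity>i\<in>I. (cmod (x i))\<^sup>2))"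
      by (rule real_sqrt_le_mono)
    then show "norm (T x) \<le> sqrt B * ell2_norm I x"
      by (simp add: ell2_norm_def real_sqrt_mult)
  next
    fix i assume i: "i \<in> I"
    have "((\<lambda>j. ell2_basis i j *\<^sub>C f j) has_sum f i) I \<longleftrightarrow> ((\<lambda>j. ell2_basis i j *\<^sub>C f j) has_sum f i) {i}"
      by (rule has_sum_cong_neutral) (use i in \<open>auto simp: ell2_basis_def\<close>)
    moreover have "((\<lambda>j. ell2_basis i j *\<^sub>C f j) has_sum f i) {i}"
      by (rule has_sum_finiteI) (auto simp: ell2_basis_def)
    ultimately show "T (ell2_basis i) = f i"
      using T[OF ell2_basis_mem[OF i]] has_sum_unique by blast
  qed
  then show thesis by (rule that)
qed

text \<open>The prospective adjoint of the synthesis operator; the value 0 off \<open>I\<close> is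
  forced by the encoding of \<open>ell2 I\<close>.\<close>

definition analysis_operator :: "'i set \<Rightarrow> ('i \<Rightarrow> 'a::complex_hilbert_space) \<Rightarrow> 'a \<Rightarrow> 'i \<Rightarrow> complex"
  where "analysis_operator I f h = (\<lambda>i. if i \<in> I then cinner h (f i) else 0)"

lemma analysis_operator_mem:
  assumes "Bessel_bound I f B"
  shows "analysis_operator I f h \<in> ell2 I"
proof -
  have "(\<lambda>i. (cmod (analysis_operator I f h i))\<^sup>2) summable_on I"
    using Bessel_bound_summable[OF assms, of h]
    by (rule summable_on_cong[THEN iffD1, rotated]) (simp add: analysis_operator_def)
  then show ?thesis
    by (simp add: ell2_def analysis_operator_def)
qed

text \<open>The definite description calls for existence and uniqueness. Existence is the termwise
  inner product of the synthesis series with \<open>w\<close>; uniqueness follows by testing on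
  basis vectors.\<close>

lemma hilbert_adjoint_synthesis:
  assumes B: "Bessel_bound I f B" and T: "synthesis_operator I f T"
  shows "hilbert_adjoint (ell2 I) (ell2_inner I) cinner T w = analysis_operator I f w"
  unfolding hilbert_adjoint_def
proof (rule the_equality)
  have "cinner (T x) w = ell2_inner I x (analysis_operator I f w)" if x: "x \<in> ell2 I" for x
  proof -
    have "((\<lambda>i. cinner (x i *\<^sub>C f i) w) has_sum cinner (T x) w) I"
      by (rule has_sum_bounded_linear[OF bounded_linear_cinner_left synthesis_operator_has_sum[OF T x]])
    also have "(\<lambda>i. cinner (x i *\<^sub>C f i) w) = (\<lambda>i. x i * cnj (cinner w (f i)))"
      unfolding cinner_scaleC_left by (metis cinner_commute)
    finally have "cinner (T x) w = (\<Sum>\<^sub>\<infinity>i\<in>I. x i * cnj (cinner w (f i)))"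
      by (simp add: infsumI)
    also have "\<dots> = ell2_inner I x (analysis_operator I f w)"
      unfolding ell2_inner_def by (rule infsum_cong) (simp add: analysis_operator_def)
    finally show ?thesis .
  qed
  then show "analysis_operator I f w \<in> ell2 I \<and>
      (\<forall>x\<in>ell2 I. cinner (T x) w = ell2_inner I x (analysis_operator I f w))"
    using analysis_operator_mem[OF B] by blast
next
  fix v assume v: "v \<in> ell2 I \<and> (\<forall>x\<in>ell2 I. cinner (T x) w = ell2_inner I x v)"
  have "v i = cinner w (f i)" if i: "i \<in> I" for i
  proof -
    have "((\<lambda>j. ell2_basis i j * cnj (v j)) has_sum cnj (v i)) I \<longleftrightarrow>
        ((\<lambda>j. ell2_basis i j * cnj (v j)) has_sum cnj (v i)) {i}"
      by (rule has_sum_cong_neutral) (use i in \<open>auto simp: ell2_basis_def\<close>)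
    moreover have "((\<lambda>j. ell2_basis i j * cnj (v j)) has_sum cnj (v i)) {i}"
      by (rule has_sum_finiteI) (auto simp: ell2_basis_def)
    ultimately have "ell2_inner I (ell2_basis i) v = cnj (v i)"
      unfolding ell2_inner_def using infsumI by blast
    moreover have "ell2_inner I (ell2_basis i) v = cinner (f i) w"
      using v ell2_basis_mem[OF i] T i unfolding synthesis_operator_def by metis
    ultimately show ?thesis
      by (metis cinner_commute complex_cnj_cnj)
  qed
  moreover have "v i = 0" if "i \<notin> I" for i
    using v that by (simp add: ell2_def)
  ultimately show "v = analysis_operator I f w"
    by (auto simp: analysis_operator_def)
qed

lemma synthesis_proj_has_sum:
  assumes T: "synthesis_operator I f T" and x: "x \<in> ell2 I" and "K \<subseteq> I"
  shows "((\<lambda>i. x i *\<^sub>C f i) has_sum T (ell2_proj K x)) K"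
proof -
  have "((\<lambda>i. x i *\<^sub>C f i) has_sum T (ell2_proj K x)) K \<longleftrightarrow>
      ((\<lambda>i. ell2_proj K x i *\<^sub>C f i) has_sum T (ell2_proj K x)) I"
    by (rule has_sum_cong_neutral) (use \<open>K \<subseteq> I\<close> in \<open>auto simp: ell2_proj_def\<close>)
  then show ?thesis
    using synthesis_operator_has_sum[OF T ell2_proj_mem[OF x]] by blast
qed

text \<open>With \<open>P\<close> the projection \<open>ell2_proj K\<close>, this is the
  factorization of the frame operator over \<open>K\<close> as \<open>T P\<close> after the adjoint
  of \<open>T\<close>. It places the range of that frame operator inside the range of
  \<open>T P\<close>.\<close>

lemma synthesis_analysis:
  assumes B: "Bessel_bound I f B" and T: "synthesis_operator I f T" and "K \<subseteq> I"
  shows "T (ell2_proj K (analysis_operator I f h)) = frame_operator K f h"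
proof -
  have "((\<lambda>i. analysis_operator I f h i *\<^sub>C f i) has_sum T (ell2_proj K (analysis_operator I f h))) K"
    by (rule synthesis_proj_has_sum[OF T analysis_operator_mem[OF B] \<open>K \<subseteq> I\<close>])
  also have "?this \<longleftrightarrow> ((\<lambda>i. cinner h (f i) *\<^sub>C f i) has_sum T (ell2_proj K (analysis_operator I f h))) K"
    by (rule has_sum_cong) (use \<open>K \<subseteq> I\<close> in \<open>auto simp: analysis_operator_def\<close>)
  finally show ?thesis
    by (simp add: frame_operator_def infsumI)
qed

section \<open>Factorization of positive operators\<close>

lemma range_deflate_subset:
  assumes "bounded_clinear A"
  shows "range (deflate A u) \<subseteq> range A"
proof -
  \<comment> \<open>The pivot is a multiple of \<open>A u\<close>, so the subtraction can be carried
    out inside the argument of \<open>A\<close>. Iterated, this keeps all pivots in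
    \<open>range A\<close> itself, not merely in its closure.\<close>
  have "deflate A u x = A (x - cinner x (pivot A u) *\<^sub>C (1 / sqrt (Re (cinner (A u) u))) *\<^sub>R u)" for x
    by (simp add: deflate_def pivot_def bounded_clinear_diff[OF assms] bounded_clinear_scaleC[OF assms]
        bounded_clinear_scaleR[OF assms])
  then show ?thesis by auto
qed

lemma pivot_in_range:
  assumes "bounded_clinear A"
  shows "pivot A u \<in> range A"
  unfolding pivot_def bounded_clinear_scaleR[OF assms, symmetric] by (rule rangeI)

text \<open>The family consists of the elimination pivots for a dense sequence. Placing it along
  \<open>\<phi>\<close>, with zeros elsewhere, allows two such families to have disjoint supports in
  one index type.\<close>

lemma positive_operator_factorization:
  fixes A :: "'a::complex_hilbert_space \<Rightarrow> 'a" and \<phi> :: "nat \<Rightarrow> 'i"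
  assumes A: "positive_operator A" and sep: "separable_space (euclidean :: 'a topology)" and "inj \<phi>"
  obtains f B where "Bessel_bound UNIV f B" and "frame_operator UNIV f = A"
    and "\<And>i. i \<notin> range \<phi> \<Longrightarrow> f i = 0" and "\<And>i. f i \<in> range A"
proof -
  obtain h :: "nat \<Rightarrow> 'a" where h: "\<And>x e. 0 < e \<Longrightarrow> \<exists>n. dist (h n) x < e"
    using separable_dense_sequence[OF sep] by blast
  define g where "g n = pivot (residual A h n) (h n)" for n
  obtain K where K: "0 < K" "\<And>x. norm (A x) \<le> K * norm x"
    using bounded_clinear_bound[OF positive_operator_clinear[OF A]] by blast
  have "(\<Sum>n\<in>F. (cmod (cinner x (g n)))\<^sup>2) \<le> K * (norm x)\<^sup>2" if "finite F" for x F
  proof -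
    obtain m where "F \<subseteq> {..<m}"
      using \<open>finite F\<close> finite_nat_iff_bounded by blast
    then have "(\<Sum>n\<in>F. (cmod (cinner x (g n)))\<^sup>2) \<le> (\<Sum>n<m. (cmod (cinner x (g n)))\<^sup>2)"
      by (intro sum_mono2) auto
    also have "\<dots> \<le> Re (cinner (A x) x)"
      using positive_operator_Re[OF positive_operator_residual[OF A], of h m x]
      unfolding cinner_residual_sum[of A x h m] g_def by simp
    also have "\<dots> \<le> norm (A x) * norm x"
      using complex_Re_le_cmod norm_cinner_le order_trans by blast
    also have "\<dots> \<le> K * (norm x)\<^sup>2"
      using mult_right_mono[OF K(2), of "norm x" x] by (simp add: power2_eq_square mult.assoc)
    finally show ?thesis .
  qed
  then have g: "Bessel_bound UNIV g K"
    using K(1) by (simp add: Bessel_bound_def)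
  have g_sum: "((\<lambda>n. cinner x (g n) *\<^sub>C g n) has_sum A x) UNIV" for x
  proof -
    have "(\<lambda>n. A x - residual A h n x) \<longlonglongrightarrow> A x - 0"
      by (intro tendsto_intros residual_tendsto_0[OF A h])
    moreover have "A x - residual A h n x = (\<Sum>k<n. cinner x (g k) *\<^sub>C g k)" for n
      using residual_sum[of A x h n] by (simp add: g_def)
    ultimately have "(\<lambda>n. cinner x (g n) *\<^sub>C g n) sums A x"
      by (simp add: sums_def)
    \<comment> \<open>The Bessel bound gives unconditional summability; the convergence of the
      residuals, which concerns one particular order, only identifies the value of the sum.\<close>
    then have "A x = frame_operator UNIV g x"
      using has_sum_imp_sums[OF frame_operator_has_sum[OF g]] sums_unique2 by blast
    then show ?thesis
      using frame_operator_has_sum[OF g] by simp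
  qed
  have "range (residual A h n) \<subseteq> range A" for n
  proof (induction n)
    case (Suc n)
    then show ?case
      using range_deflate_subset[OF positive_operator_clinear[OF positive_operator_residual[OF A]], of h n "h n"]
      by simp
  qed simp
  then have g_range: "g n \<in> range A" for n
    unfolding g_def using pivot_in_range[OF positive_operator_clinear[OF positive_operator_residual[OF A]]]
    by blast
  define f where "f i = (if i \<in> range \<phi> then g (inv \<phi> i) else 0)" for i
  have f: "f (\<phi> n) = g n" for n
    using \<open>inj \<phi>\<close> by (simp add: f_def)
  have "(\<Sum>i\<in>F. (cmod (cinner x (f i)))\<^sup>2) \<le> K * (norm x)\<^sup>2" if "finite F" for x F
  proof -
    have "(\<Sum>i\<in>F. (cmod (cinner x (f i)))\<^sup>2) = (\<Sum>i\<in>\<phi> ` (\<phi> -` F). (cmod (cinner x (f i)))\<^sup>2)"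
      using \<open>finite F\<close> by (intro sum.mono_neutral_right) (auto simp: f_def)
    also have "\<dots> = (\<Sum>n\<in>\<phi> -` F. (cmod (cinner x (g n)))\<^sup>2)"
      using \<open>inj \<phi>\<close> by (subst sum.reindex) (auto simp: f intro: inj_on_subset)
    also have "\<dots> \<le> K * (norm x)\<^sup>2"
      using Bessel_boundD[OF g finite_vimageI[OF \<open>finite F\<close> \<open>inj \<phi>\<close>]] by simp
    finally show ?thesis .
  qed
  then have Bf: "Bessel_bound UNIV f K"
    using K(1) by (simp add: Bessel_bound_def)
  moreover have "frame_operator UNIV f x = A x" for x
  proof -
    have "((\<lambda>i. cinner x (f i) *\<^sub>C f i) has_sum A x) (range \<phi>)"
      using g_sum[of x] by (simp add: has_sum_reindex[OF \<open>inj \<phi>\<close>] o_def f)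
    moreover have "?this \<longleftrightarrow> ((\<lambda>i. cinner x (f i) *\<^sub>C f i) has_sum A x) UNIV"
      by (rule has_sum_cong_neutral) (auto simp: f_def)
    ultimately show ?thesis
      by (simp add: frame_operator_def infsumI)
  qed
  then have "frame_operator UNIV f = A" ..
  moreover have "f i \<in> range A" for i
    using g_range complex_vector.subspace_0[OF subspace_range[OF positive_operator_clinear[OF A]]]
    by (simp add: f_def del: image_iff)
  ultimately show thesis
    using that[of f K] by (auto simp: f_def)
qed

section \<open>The indefinite inner product\<close>

context krein_space
begin

text \<open>The locale determines \<open>J\<close> only through \<open>ip_eq_cinner_J\<close>, so
  even linearity has to be read off from inner products with arbitrary vectors.\<close>

lemma J_add: "J (x + y) = J x + J y"
  by (rule cinner_eqI) (simp add: cinner_add_left ip_add_left flip: ip_eq_cinner_J)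

lemma J_scaleC: "J (c *\<^sub>C x) = c *\<^sub>C J x"
  by (rule cinner_eqI) (simp add: cinner_scaleC_left ip_scaleC_left flip: ip_eq_cinner_J)

lemma cinner_J_commute: "cinner (J x) y = cinner x (J y)"
  by (metis cinner_commute ip_commute ip_eq_cinner_J)

text \<open>On decomposed vectors \<open>ip\<close> and \<open>cinner\<close> differ only in the
  sign of the \<open>Hm\<close> part, so \<open>J\<close> is the identity on \<open>Hp\<close> and
  minus the identity on \<open>Hm\<close>.\<close>

lemma J_decomp:
  assumes "p \<in> Hp" "m \<in> Hm"
  shows "J (p + m) = p - m"
proof (rule cinner_eqI)
  fix z
  obtain p' m' where z: "p' \<in> Hp" "m' \<in> Hm" "z = p' + m'"
    using Hp_Hm_sum by blast
  have minus_m: "- m \<in> Hm"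
    using assms(2) subspace_Hm complex_vector.subspace_neg by blast
  have add_right: "ip x (y + w) = ip x y + ip x w" for x y w
    by (simp add: ip_eq_cinner_J cinner_add_right)
  have "ip (p + m) z = ip p p' + ip m m'"
    using assms z ip_orthogonal ip_commute[of p' m]
    by (simp add: ip_add_left add_right)
  moreover have "cinner (p - m) z = ip p p' - ip (- m) m'"
    using cinner_decomp[OF assms(1) z(1) minus_m z(2)] z(3) by simp
  moreover have "ip (- m) m' = - ip m m'"
    using ip_scaleC_left[of "- 1" m m'] by simp
  ultimately show "cinner (J (p + m)) z = cinner (p - m) z"
    by (simp flip: ip_eq_cinner_J)
qed

lemma J_J [simp]: "J (J x) = x"
proof -
  obtain p m where x: "p \<in> Hp" "m \<in> Hm" "x = p + m"
    using Hp_Hm_sum by blast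
  then have "- m \<in> Hm"
    using subspace_Hm complex_vector.subspace_neg by blast
  then show ?thesis
    using J_decomp[OF x(1), of "- m"] J_decomp[OF x(1,2)] x(3) by simp
qed

lemma norm_J [simp]: "norm (J x) = norm x"
proof -
  have "complex_of_real ((norm (J x))\<^sup>2) = complex_of_real ((norm x)\<^sup>2)"
    unfolding cinner_self[symmetric] by (simp add: cinner_J_commute)
  then show ?thesis
    by (metis norm_ge_zero of_real_eq_iff power2_eq_imp_eq)
qed

lemma bounded_clinear_J: "bounded_clinear J"
  by (rule bounded_clinearI[where K = 1]) (auto simp: J_add J_scaleC)

lemma norm_ip_le: "cmod (ip x y) \<le> norm x * norm y"
  using norm_cinner_le[of "J x" y] by (simp add: ip_eq_cinner_J)

lemma ip_minus_left: "ip (- x) y = - ip x y"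
  by (simp add: ip_eq_cinner_J bounded_clinear_minus[OF bounded_clinear_J] cinner_minus_left)

text \<open>Substituting \<open>J x\<close> for \<open>x\<close> in the form of \<open>A\<close>
  moves one \<open>J\<close> across the inner product. Composition with \<open>J\<close> on the
  right thus links the two notions of positivity, in either direction.\<close>

lemma J_positive_imp_positive_operator:
  assumes "J_positive ip A"
  shows "positive_operator (A \<circ> J)"
proof -
  have "cinner (A (J x)) x = ip (A (J x)) (J x)" for x
    by (simp add: ip_eq_cinner_J cinner_J_commute)
  then show ?thesis
    using assms bounded_clinear_comp[OF _ bounded_clinear_J] by (auto simp: J_positive_def)
qed

lemma positive_operator_imp_J_positive:
  assumes "positive_operator A"
  shows "J_positive ip (A \<circ> J)"
proof -
  have "ip (A (J x)) x = cinner (A (J x)) (J x)" for x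
    by (simp add: ip_eq_cinner_J cinner_J_commute)
  then show ?thesis
    using assms bounded_clinear_comp[OF _ bounded_clinear_J] by (auto simp: J_positive_def)
qed

lemma J_negative_iff_J_positive_uminus: "J_negative ip A \<longleftrightarrow> J_positive ip (\<lambda>x. - A x)"
proof -
  have "bounded_clinear (\<lambda>x. - A x) \<Longrightarrow> bounded_clinear A"
    using bounded_clinear_uminus[of "\<lambda>x. - A x"] by simp
  then show ?thesis
    unfolding J_negative_def J_positive_def using bounded_clinear_uminus[of A]
    by (auto simp: ip_minus_left complex_nonneg_Reals_iff complex_nonpos_Reals_iff)
qed

section \<open>Uniformly definite subspaces and their direct sums\<close>

lemma uniformly_J_positive_subset:
  "uniformly_J_positive ip M \<Longrightarrow> complex_vector.subspace N \<Longrightarrow> N \<subseteq> M \<Longrightarrow> uniformly_J_positive ip N"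
  unfolding uniformly_J_positive_def by blast

lemma uniformly_J_negative_subset:
  "uniformly_J_negative ip M \<Longrightarrow> complex_vector.subspace N \<Longrightarrow> N \<subseteq> M \<Longrightarrow> uniformly_J_negative ip N"
  unfolding uniformly_J_negative_def by blast

lemma uniformly_J_positive_pos:
  assumes "uniformly_J_positive ip M" "x \<in> M" "x \<noteq> 0"
  shows "0 < Re (ip x x)"
proof -
  obtain \<alpha> where "0 < \<alpha>" "\<alpha> * (norm x)\<^sup>2 \<le> Re (ip x x)"
    using assms unfolding uniformly_J_positive_def by blast
  moreover have "0 < \<alpha> * (norm x)\<^sup>2"
    using \<open>0 < \<alpha>\<close> \<open>x \<noteq> 0\<close> by simp
  ultimately show ?thesis by linarith
qed

lemma uniformly_J_negative_neg:
  assumes "uniformly_J_negative ip N" "x \<in> N" "x \<noteq> 0"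
  shows "Re (ip x x) < 0"
proof -
  obtain \<alpha> where "0 < \<alpha>" "Re (ip x x) \<le> - \<alpha> * (norm x)\<^sup>2"
    using assms unfolding uniformly_J_negative_def by blast
  moreover have "0 < \<alpha> * (norm x)\<^sup>2"
    using \<open>0 < \<alpha>\<close> \<open>x \<noteq> 0\<close> by simp
  ultimately show ?thesis by simp
qed

text \<open>The vector \<open>x - x' = y' - y\<close> lies in \<open>M\<close> and in
  \<open>N\<close>; if it were nonzero, the form would be both positive and negative on it.\<close>

lemma uniformly_J_definite_decomp_unique:
  assumes M: "uniformly_J_positive ip M" and N: "uniformly_J_negative ip N"
    and "x \<in> M" "x' \<in> M" "y \<in> N" "y' \<in> N" "x + y = x' + y'"
  shows "x = x'"
proof (rule ccontr)
  assume "x \<noteq> x'"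
  have "x - x' = y' - y"
    using assms(7) by (simp add: algebra_simps)
  moreover have "x - x' \<in> M" "y' - y \<in> N"
    using assms complex_vector.subspace_diff
    unfolding uniformly_J_positive_def uniformly_J_negative_def by blast+
  ultimately show False
    using uniformly_J_positive_pos[OF M] uniformly_J_negative_neg[OF N] \<open>x \<noteq> x'\<close>
    by (metis eq_iff_diff_eq_0 less_asym)
qed

text \<open>
  The mixed terms of \<open>[x + y, x - y]\<close> are purely imaginary, so its real part dominates a multiple of
  \<open>norm x ^ 2 + norm y ^ 2\<close>.
\<close>

lemma uniformly_J_definite_decomp_bound:
  assumes M: "uniformly_J_positive ip M" and N: "uniformly_J_negative ip N"
  obtains C where "\<And>x y. x \<in> M \<Longrightarrow> y \<in> N \<Longrightarrow> norm x \<le> C * norm (x + y)"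
proof -
  obtain \<alpha> \<beta> where \<alpha>: "0 < \<alpha>" "\<And>x. x \<in> M \<Longrightarrow> \<alpha> * (norm x)\<^sup>2 \<le> Re (ip x x)"
    and \<beta>: "0 < \<beta>" "\<And>y. y \<in> N \<Longrightarrow> Re (ip y y) \<le> - \<beta> * (norm y)\<^sup>2"
    using M N unfolding uniformly_J_positive_def uniformly_J_negative_def by blast
  define \<gamma> where "\<gamma> = min \<alpha> \<beta>"
  have \<gamma>: "0 < \<gamma>" "\<gamma> \<le> \<alpha>" "\<gamma> \<le> \<beta>"
    using \<alpha>(1) \<beta>(1) by (auto simp: \<gamma>_def)
  have "norm x \<le> (2 / \<gamma>) * norm (x + y)" if x: "x \<in> M" and y: "y \<in> N" for x y
  proof -
    \<comment> \<open>The sum \<open>s\<close> dominates \<open>norm (x - y)\<close>, while its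
      square is at most twice the sum of the squared norms. Both sides are compared through
      \<open>s\<close>, and one factor \<open>s\<close> cancels.\<close>
    define s where "s = norm x + norm y"
    have "ip (x + y) (x - y) = ip x x - ip y y + (ip y x - ip x y)"
      by (simp add: ip_add_left) (simp add: ip_eq_cinner_J cinner_diff_right)
    moreover have "Re (ip y x - ip x y) = 0"
      using ip_commute[of x y] by simp
    ultimately have "Re (ip x x) - Re (ip y y) = Re (ip (x + y) (x - y))"
      by simp
    also have "\<dots> \<le> norm (x + y) * norm (x - y)"
      using complex_Re_le_cmod norm_ip_le order_trans by blast
    also have "\<dots> \<le> norm (x + y) * s"
      unfolding s_def by (intro mult_left_mono norm_triangle_ineq4) simp
    finally have "Re (ip x x) - Re (ip y y) \<le> norm (x + y) * s" .
    moreover have "\<gamma> * (norm x)\<^sup>2 \<le> Re (ip x x)"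
      using \<alpha>(2)[OF x] \<gamma>(2) by (meson mult_right_mono order_trans zero_le_power2)
    moreover have "\<gamma> * (norm y)\<^sup>2 \<le> - Re (ip y y)"
      using \<beta>(2)[OF y] mult_right_mono[OF \<gamma>(3), of "(norm y)\<^sup>2"] by simp
    moreover have "s\<^sup>2 \<le> 2 * ((norm x)\<^sup>2 + (norm y)\<^sup>2)"
      using sum_squares_bound[of "norm x" "norm y"] by (simp add: s_def power2_sum)
    then have "\<gamma> * s\<^sup>2 \<le> \<gamma> * (2 * ((norm x)\<^sup>2 + (norm y)\<^sup>2))"
      using \<gamma>(1) by (intro mult_left_mono) auto
    ultimately have *: "\<gamma> * s * s \<le> 2 * norm (x + y) * s"
      by (simp add: power2_eq_square algebra_simps)
    have "\<gamma> * s \<le> 2 * norm (x + y)"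
    proof (cases "s = 0")
      case False
      then have "0 < s" by (auto simp: s_def add_nonneg_eq_0_iff less_le)
      then show ?thesis using * by simp
    qed simp
    then have "s \<le> (2 / \<gamma>) * norm (x + y)"
      using \<gamma>(1) by (simp add: field_simps)
    then show ?thesis
      using norm_ge_zero[of y] unfolding s_def by linarith
  qed
  then show thesis by (rule that)
qed

text \<open>A vector \<open>z\<close> of a larger definite subspace has a decomposition
  \<open>x + y\<close> along \<open>M\<close> and \<open>N\<close>. Uniqueness, applied with the
  larger subspace in place of the smaller one, compares it with the trivial decomposition of
  \<open>z\<close>.\<close>

lemma uniformly_J_definite_decomp_maximal:
  assumes M: "uniformly_J_positive ip M" and N: "uniformly_J_negative ip N"
    and sum: "\<And>z. \<exists>x\<in>M. \<exists>y\<in>N. z = x + y"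
  shows "maximal_uniformly_J_positive ip M" and "maximal_uniformly_J_negative ip N"
proof -
  have zeros: "0 \<in> M" "0 \<in> N"
    using M N complex_vector.subspace_0
    unfolding uniformly_J_positive_def uniformly_J_negative_def by blast+
  show "maximal_uniformly_J_positive ip M"
    unfolding maximal_uniformly_J_positive_def
  proof (intro conjI allI impI M)
    fix M' assume M': "uniformly_J_positive ip M' \<and> M \<subseteq> M'"
    show "M' = M"
    proof
      show "M' \<subseteq> M"
      proof
        fix z assume "z \<in> M'"
        obtain x y where xy: "x \<in> M" "y \<in> N" "z = x + y"
          using sum by blast
        then have "z = x"
          using uniformly_J_definite_decomp_unique[of M' N z x 0 y] M' N \<open>z \<in> M'\<close> zeros by auto
        then show "z \<in> M" using xy by simp
      qed
    qed (use M' in simp)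
  qed
  show "maximal_uniformly_J_negative ip N"
    unfolding maximal_uniformly_J_negative_def
  proof (intro conjI allI impI N)
    fix N' assume N': "uniformly_J_negative ip N' \<and> N \<subseteq> N'"
    show "N' = N"
    proof
      show "N' \<subseteq> N"
      proof
        fix z assume "z \<in> N'"
        obtain x y where xy: "x \<in> M" "y \<in> N" "z = x + y"
          using sum by blast
        then have "0 = x"
          using uniformly_J_definite_decomp_unique[of M N' 0 x z y] N' M \<open>z \<in> N'\<close> zeros by auto
        then show "z \<in> N" using xy by simp
      qed
    qed (use N' in simp)
  qed
qed

text \<open>\<open>Q\<close> is the projection onto \<open>M\<close> along \<open>N\<close>; its
  boundedness is the quantitative estimate \<open>uniformly_J_definite_decomp_bound\<close>.\<close>

lemma uniformly_J_definite_decomp_projection: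
  assumes M: "uniformly_J_positive ip M" and N: "uniformly_J_negative ip N"
    and sum: "\<And>z. \<exists>x\<in>M. \<exists>y\<in>N. z = x + y"
  obtains Q where "Q \<in> Q_projections ip" and "\<And>x y. x \<in> M \<Longrightarrow> y \<in> N \<Longrightarrow> Q (x + y) = x"
proof -
  have subM: "complex_vector.subspace M" and subN: "complex_vector.subspace N"
    using M N by (auto simp: uniformly_J_positive_def uniformly_J_negative_def)
  note zeros = complex_vector.subspace_0[OF subM] complex_vector.subspace_0[OF subN]
  define Q where "Q z = (SOME x. x \<in> M \<and> (\<exists>y\<in>N. z = x + y))" for z
  have Q: "Q (x + y) = x" if "x \<in> M" "y \<in> N" for x y
  proof -
    have "Q (x + y) \<in> M \<and> (\<exists>y'\<in>N. x + y = Q (x + y) + y')"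
      unfolding Q_def by (rule someI[where x = x]) (use that in blast)
    then show ?thesis
      using uniformly_J_definite_decomp_unique[OF M N] that by metis
  qed
  obtain C where C: "norm x \<le> C * norm (x + y)" if "x \<in> M" "y \<in> N" for x y
    using uniformly_J_definite_decomp_bound[OF M N] by blast
  have "bounded_clinear Q"
  proof (rule bounded_clinearI)
    fix z z' and c :: complex
    obtain x y x' y' where z: "x \<in> M" "y \<in> N" "z = x + y" and z': "x' \<in> M" "y' \<in> N" "z' = x' + y'"
      using sum by meson
    have "Q ((x + x') + (y + y')) = x + x'"
      by (intro Q complex_vector.subspace_add[OF subM] complex_vector.subspace_add[OF subN] z z')
    then show "Q (z + z') = Q z + Q z'"
      using Q z z' by (simp add: algebra_simps)
    have "Q (c *\<^sub>C x + c *\<^sub>C y) = c *\<^sub>C x"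
      by (intro Q complex_vector.subspace_scale[OF subM] complex_vector.subspace_scale[OF subN] z)
    then show "Q (c *\<^sub>C z) = c *\<^sub>C Q z"
      using Q z by (simp add: scaleC_add_right)
    show "norm (Q z) \<le> C * norm z"
      using C Q z by simp
  qed
  moreover have Q_M: "Q x = x" if "x \<in> M" for x
    using Q[OF that zeros(2)] by simp
  have mem: "Q z \<in> M" for z
    using sum[of z] Q by auto
  then have "Q \<circ> Q = Q"
    using Q_M by auto
  moreover have "range Q = M"
    using mem Q_M by (metis image_subset_iff rangeI subsetI subset_antisym)
  moreover have "{z. Q z = 0} = N"
  proof
    show "{z. Q z = 0} \<subseteq> N"
      using sum Q by (metis (mono_tags, lifting) add_0 mem_Collect_eq subsetI)
    show "N \<subseteq> {z. Q z = 0}"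
      using Q[OF zeros(1)] by auto
  qed
  ultimately have "Q \<in> Q_projections ip"
    using M N by (simp add: Q_projections_def)
  then show thesis
    using Q by (rule that)
qed

end

section \<open>\<open>J\<close>-frame operators\<close>

lemma ell2_symmetry_mem: "x \<in> ell2 I \<Longrightarrow> ell2_symmetry ip I f x \<in> ell2 I"
proof -
  assume x: "x \<in> ell2 I"
  have "(\<lambda>i. (cmod (ell2_symmetry ip I f x i))\<^sup>2) = (\<lambda>i. (cmod (x i))\<^sup>2)"
    by (auto simp: ell2_symmetry_def norm_mult)
  then show ?thesis
    using x by (simp add: ell2_def) (simp add: ell2_symmetry_def)
qed

lemma index_pos_neg:
  "index_pos ip I f \<union> index_neg ip I f = I" "index_pos ip I f \<inter> index_neg ip I f = {}"
  by (auto simp: index_pos_def index_neg_def)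

text \<open>The rightmost factor of the \<open>J\<close>-adjoint gives the argument
  \<open>J w\<close>; the symmetry of l2(I) reverses the coefficients with negative index, and the
  series splits over the two disjoint index sets.\<close>

lemma synthesis_J_adjoint:
  assumes B: "Bessel_bound I f B" and T: "synthesis_operator I f T"
  shows "T (J_adjoint (ell2 I) (ell2_inner I) (ell2_symmetry ip I f) cinner J T w) =
    frame_operator (index_pos ip I f) f (J w) - frame_operator (index_neg ip I f) f (J w)"
proof -
  let ?P = "index_pos ip I f" and ?N = "index_neg ip I f"
  define x where "x = ell2_symmetry ip I f (analysis_operator I f (J w))"
  have x_pos: "x i = cinner (J w) (f i)" if "i \<in> ?P" for i
    using that by (simp add: x_def ell2_symmetry_def analysis_operator_def index_pos_def)
  have x_neg: "x i = - cinner (J w) (f i)" if "i \<in> ?N" for i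
    using that by (simp add: x_def ell2_symmetry_def analysis_operator_def index_pos_def index_neg_def)
  have "((\<lambda>i. x i *\<^sub>C f i) has_sum frame_operator ?P f (J w)) ?P \<longleftrightarrow>
      ((\<lambda>i. cinner (J w) (f i) *\<^sub>C f i) has_sum frame_operator ?P f (J w)) ?P"
    by (rule has_sum_cong) (simp add: x_pos)
  moreover have "((\<lambda>i. cinner (J w) (f i) *\<^sub>C f i) has_sum frame_operator ?P f (J w)) ?P"
    by (rule frame_operator_has_sum[OF Bessel_bound_subset[OF B]])
      (auto simp: index_pos_def)
  ultimately have P: "((\<lambda>i. x i *\<^sub>C f i) has_sum frame_operator ?P f (J w)) ?P"
    by blast
  have "((\<lambda>i. x i *\<^sub>C f i) has_sum - frame_operator ?N f (J w)) ?N \<longleftrightarrow>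
      ((\<lambda>i. - (cinner (J w) (f i) *\<^sub>C f i)) has_sum - frame_operator ?N f (J w)) ?N"
    by (rule has_sum_cong) (simp add: x_neg)
  moreover have "((\<lambda>i. cinner (J w) (f i) *\<^sub>C f i) has_sum frame_operator ?N f (J w)) ?N"
    by (rule frame_operator_has_sum[OF Bessel_bound_subset[OF B]])
      (auto simp: index_pos_def index_neg_def)
  then have "((\<lambda>i. - (cinner (J w) (f i) *\<^sub>C f i)) has_sum - frame_operator ?N f (J w)) ?N"
    by (simp only: has_sum_uminus minus_minus)
  ultimately have "((\<lambda>i. x i *\<^sub>C f i) has_sum - frame_operator ?N f (J w)) ?N"
    by blast
  from has_sum_Un_disjoint[OF P this index_pos_neg(2)]
  have "((\<lambda>i. x i *\<^sub>C f i) has_sum frame_operator ?P f (J w) - frame_operator ?N f (J w)) I"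
    by (simp add: index_pos_neg(1))
  moreover have "((\<lambda>i. x i *\<^sub>C f i) has_sum T x) I"
    unfolding x_def
    by (intro synthesis_operator_has_sum[OF T] ell2_symmetry_mem analysis_operator_mem[OF B])
  ultimately have "T x = frame_operator ?P f (J w) - frame_operator ?N f (J w)"
    by (rule has_sum_unique[rotated])
  then show ?thesis
    by (simp add: J_adjoint_def hilbert_adjoint_synthesis[OF B T] x_def)
qed

section \<open>Implications between the three conditions\<close>

context krein_space
begin

lemma J_frame_operator_imp_difference:
  assumes "J_frame_operator TYPE('i) ip J S"
  shows "\<exists>S1 S2. J_positive ip S1 \<and> J_positive ip S2 \<and> S = (\<lambda>x. S1 x - S2 x) \<and>
    uniformly_J_positive ip (range S1) \<and> uniformly_J_negative ip (range S2)"
proof -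
  obtain I :: "'i set" and f T where frame: "J_frame ip I f" and T: "synthesis_operator I f T"
    and S: "S = T \<circ> J_adjoint (ell2 I) (ell2_inner I) (ell2_symmetry ip I f) cinner J T"
    using assms unfolding J_frame_operator_def by blast
  let ?P = "index_pos ip I f" and ?N = "index_neg ip I f"
  obtain B where B: "Bessel_bound I f B"
    using frame Bessel_family_bound unfolding J_frame_def by metis
  \<comment> \<open>\<open>J_frame\<close> supplies its own synthesis operator \<open>T'\<close>,
    while \<open>T\<close> is the one occurring in \<open>S\<close>. \<open>T\<close> serves the
    formula for \<open>S\<close>, and \<open>T'\<close> the inclusions of the ranges.\<close>
  obtain T' where T': "synthesis_operator I f T'"
    and pos: "uniformly_J_positive ip ((T' \<circ> ell2_proj ?P) ` ell2 I)"
    and neg: "uniformly_J_negative ip ((T' \<circ> ell2_proj ?N) ` ell2 I)"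
    using frame
    by (auto simp: J_frame_def maximal_uniformly_J_positive_def maximal_uniformly_J_negative_def)
  have sub: "?P \<subseteq> I" "?N \<subseteq> I"
    by (auto simp: index_pos_def index_neg_def)
  define S1 where "S1 = frame_operator ?P f \<circ> J"
  define S2 where "S2 = frame_operator ?N f \<circ> J"
  have S1: "J_positive ip S1"
    unfolding S1_def
    by (rule positive_operator_imp_J_positive[OF positive_operator_frame_operator[OF
            Bessel_bound_subset[OF B sub(1)]]])
  have S2: "J_positive ip S2"
    unfolding S2_def
    by (rule positive_operator_imp_J_positive[OF positive_operator_frame_operator[OF
            Bessel_bound_subset[OF B sub(2)]]])
  have "bounded_clinear S1" "bounded_clinear S2"
    using S1 S2 by (simp_all add: J_positive_def)
  have diff: "S = (\<lambda>x. S1 x - S2 x)"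
    unfolding S by (rule ext) (simp only: comp_apply synthesis_J_adjoint[OF B T] S1_def S2_def)
  have range: "range (frame_operator K f \<circ> J) \<subseteq> (T' \<circ> ell2_proj K) ` ell2 I" if "K \<subseteq> I" for K
  proof
    fix y assume "y \<in> range (frame_operator K f \<circ> J)"
    then obtain w where "y = T' (ell2_proj K (analysis_operator I f (J w)))"
      using synthesis_analysis[OF B T' \<open>K \<subseteq> I\<close>] by auto
    then show "y \<in> (T' \<circ> ell2_proj K) ` ell2 I"
      using analysis_operator_mem[OF B] by auto
  qed
  have "uniformly_J_positive ip (range S1)"
    by (rule uniformly_J_positive_subset[OF pos subspace_range range[OF sub(1), folded S1_def]]) fact
  moreover have "uniformly_J_negative ip (range S2)"
    by (rule uniformly_J_negative_subset[OF neg subspace_range range[OF sub(2), folded S2_def]]) fact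
  ultimately show ?thesis
    using S1 S2 diff by (intro exI conjI)
qed

text \<open>Surjectivity of \<open>S\<close> makes the two ranges span the space. Projecting
  \<open>S u = S1 u + (- S2 u)\<close> onto \<open>range S1\<close> along \<open>range S2\<close>
  gives \<open>Q \<circ> S = S1\<close>, and the complementary part is \<open>- S2\<close>.\<close>

lemma difference_imp_projection:
  assumes "surj S"
    and S1: "J_positive ip S1" and S2: "J_positive ip S2" and S: "S = (\<lambda>x. S1 x - S2 x)"
    and pos: "uniformly_J_positive ip (range S1)" and neg: "uniformly_J_negative ip (range S2)"
  shows "\<exists>Q\<in>Q_projections ip. J_positive ip (Q \<circ> S) \<and> J_negative ip ((\<lambda>x. x - Q x) \<circ> S)"
proof -
  have minus_S2: "- S2 u \<in> range S2" for u
    using S2 bounded_clinear_minus[of S2 u] unfolding J_positive_def by (metis rangeI)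
  have "\<exists>x\<in>range S1. \<exists>y\<in>range S2. z = x + y" for z
  proof -
    obtain u where "z = S u"
      using \<open>surj S\<close> by blast
    then have "z = S1 u + - S2 u"
      by (simp add: S)
    then show ?thesis
      using minus_S2[of u] by blast
  qed
  then obtain Q where Q: "Q \<in> Q_projections ip"
    and eq: "\<And>x y. x \<in> range S1 \<Longrightarrow> y \<in> range S2 \<Longrightarrow> Q (x + y) = x"
    using uniformly_J_definite_decomp_projection[OF pos neg] by blast
  have "Q (S u) = S1 u" for u
    using eq[of "S1 u" "- S2 u"] minus_S2[of u] by (simp add: S)
  then have "Q \<circ> S = S1" "(\<lambda>x. x - Q x) \<circ> S = (\<lambda>x. - S2 x)"
    by (auto simp: S fun_eq_iff)
  then show ?thesis
    using Q S1 S2 by (intro bexI[of _ Q]) (auto simp: J_negative_iff_J_positive_uminus)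
qed

text \<open>The two parts of \<open>S\<close> cut out by \<open>Q\<close>, the second with reversed
  sign, have ranges inside the range and the nullspace of \<open>Q\<close>, and definiteness is
  inherited by subspaces.\<close>

lemma projection_imp_difference:
  assumes Q: "Q \<in> Q_projections ip"
    and pos: "J_positive ip (Q \<circ> S)" and neg: "J_negative ip ((\<lambda>x. x - Q x) \<circ> S)"
  shows "\<exists>S1 S2. J_positive ip S1 \<and> J_positive ip S2 \<and> S = (\<lambda>x. S1 x - S2 x) \<and>
    uniformly_J_positive ip (range S1) \<and> uniformly_J_negative ip (range S2)"
proof (intro exI conjI)
  have lin: "bounded_clinear Q" and idem: "\<And>x. Q (Q x) = Q x"
    using Q unfolding Q_projections_def by (auto simp: fun_eq_iff)
  define S2 where "S2 x = - ((\<lambda>x. x - Q x) \<circ> S) x" for x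
  show "J_positive ip (Q \<circ> S)" by fact
  show S2: "J_positive ip S2"
    using neg unfolding J_negative_iff_J_positive_uminus S2_def .
  show "S = (\<lambda>x. (Q \<circ> S) x - S2 x)"
    by (simp add: S2_def)
  show "uniformly_J_positive ip (range (Q \<circ> S))"
  proof (rule uniformly_J_positive_subset)
    show "uniformly_J_positive ip (range Q)"
      using Q by (simp add: Q_projections_def)
    show "complex_vector.subspace (range (Q \<circ> S))"
      using pos unfolding J_positive_def by (intro subspace_range) simp
  qed auto
  show "uniformly_J_negative ip (range S2)"
  proof (rule uniformly_J_negative_subset)
    show "uniformly_J_negative ip {x. Q x = 0}"
      using Q by (simp add: Q_projections_def)
    show "complex_vector.subspace (range S2)"
      using S2 by (simp add: J_positive_def subspace_range)
    show "range S2 \<subseteq> {x. Q x = 0}"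
      by (auto simp: S2_def bounded_clinear_diff[OF lin] idem)
  qed
qed

lemma projection_imp_J_frame_operator:
  assumes "infinite (UNIV :: 'i set)" and "surj S"
    and Q: "Q \<in> Q_projections ip"
    and pos: "J_positive ip (Q \<circ> S)" and neg: "J_negative ip ((\<lambda>x. x - Q x) \<circ> S)"
  shows "J_frame_operator TYPE('i) ip J S"
proof -
  have lin: "bounded_clinear Q" and idem: "\<And>x. Q (Q x) = Q x"
    and rangeQ: "uniformly_J_positive ip (range Q)" and kerQ: "uniformly_J_negative ip {x. Q x = 0}"
    using Q unfolding Q_projections_def by (auto simp: fun_eq_iff)
  define A1 where "A1 = (Q \<circ> S) \<circ> J"
  define A2 where "A2 = (\<lambda>x. - ((\<lambda>x. x - Q x) \<circ> S) x) \<circ> J"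
  have A1: "positive_operator A1"
    unfolding A1_def by (rule J_positive_imp_positive_operator[OF pos])
  have A2: "positive_operator A2"
    unfolding A2_def
    by (rule J_positive_imp_positive_operator[OF neg[unfolded J_negative_iff_J_positive_uminus]])
  obtain \<phi> :: "nat \<Rightarrow> 'i" where \<phi>: "inj \<phi>"
    using infinite_countable_subset[OF assms(1)] by blast
  \<comment> \<open>Even and odd numbers give the two families disjoint supports, so their pointwise
    sum is in effect their disjoint union.\<close>
  have inj: "inj (\<lambda>n. \<phi> (2 * n))" "inj (\<lambda>n. \<phi> (2 * n + 1))"
    by (auto intro!: injI dest!: injD[OF \<phi>])
  obtain f1 B1 where B1: "Bessel_bound UNIV f1 B1" and f1_A1: "frame_operator UNIV f1 = A1"
    and supp1: "\<And>i. i \<notin> range (\<lambda>n. \<phi> (2 * n)) \<Longrightarrow> f1 i = 0" and range1: "\<And>i. f1 i \<in> range A1"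
    by (rule positive_operator_factorization[OF A1 separable inj(1)]) iprover
  obtain f2 B2 where B2: "Bessel_bound UNIV f2 B2" and f2_A2: "frame_operator UNIV f2 = A2"
    and supp2: "\<And>i. i \<notin> range (\<lambda>n. \<phi> (2 * n + 1)) \<Longrightarrow> f2 i = 0" and range2: "\<And>i. f2 i \<in> range A2"
    by (rule positive_operator_factorization[OF A2 separable inj(2)]) iprover
  have disj: "f1 i = 0 \<or> f2 i = 0" for i
  proof (rule ccontr)
    assume "\<not> (f1 i = 0 \<or> f2 i = 0)"
    then have "i \<in> range (\<lambda>n. \<phi> (2 * n))" "i \<in> range (\<lambda>n. \<phi> (2 * n + 1))"
      using supp1[of i] supp2[of i] by blast+
    then obtain m n where "\<phi> (2 * m) = \<phi> (2 * n + 1)"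
      by (elim imageE) simp
    then have "2 * m = 2 * n + 1"
      using \<phi> by (simp add: inj_eq)
    then show False by presburger
  qed
  have Qf1: "Q (f1 i) = f1 i" and Qf2: "Q (f2 i) = 0" for i
    using range1[of i] range2[of i]
    by (auto simp: A1_def A2_def idem bounded_clinear_minus[OF lin] bounded_clinear_diff[OF lin])
  define f where "f i = f1 i + f2 i" for i
  \<comment> \<open>A zero vector would count as an index of positive type. Without zeros, the
    positive and negative indices are exactly the supports of \<open>f1\<close> and
    \<open>f2\<close>.\<close>
  define I where "I = {i. f i \<noteq> 0}"
  have f1_pos: "0 < Re (ip (f1 i) (f1 i))" if "f1 i \<noteq> 0" for i
    using uniformly_J_positive_pos[OF rangeQ rangeI, of "f1 i"] that Qf1 by simp
  have f2_neg: "Re (ip (f2 i) (f2 i)) < 0" if "f2 i \<noteq> 0" for i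
    using uniformly_J_negative_neg[OF kerQ] that Qf2 by simp
  have P: "index_pos ip I f = {i. f1 i \<noteq> 0}"
    using disj f1_pos f2_neg by (force simp: index_pos_def I_def f_def less_le not_le)
  have N: "index_neg ip I f = {i. f2 i \<noteq> 0}"
    using disj f1_pos f2_neg by (force simp: index_neg_def I_def f_def less_le not_le)
  have sub: "{i. f1 i \<noteq> 0} \<subseteq> I" "{i. f2 i \<noteq> 0} \<subseteq> I"
    using disj by (force simp: I_def f_def)+
  have "(\<Sum>i\<in>F. (cmod (cinner h (f i)))\<^sup>2) \<le> (B1 + B2) * (norm h)\<^sup>2" if "finite F" for h F
  proof -
    have "(cmod (cinner h (f i)))\<^sup>2 = (cmod (cinner h (f1 i)))\<^sup>2 + (cmod (cinner h (f2 i)))\<^sup>2" for i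
      using disj[of i] by (auto simp: f_def)
    then show ?thesis
      using Bessel_boundD[OF B1 that, of h] Bessel_boundD[OF B2 that, of h]
      by (simp add: sum.distrib distrib_right)
  qed
  then have B: "Bessel_bound I f (B1 + B2)"
    using Bessel_bound_nonneg[OF B1] Bessel_bound_nonneg[OF B2] by (simp add: Bessel_bound_def)
  obtain T where T: "synthesis_operator I f T"
    using synthesis_operator_exists[OF B] .
  have FP: "frame_operator {i. f1 i \<noteq> 0} f = A1"
    unfolding f1_A1[symmetric] frame_operator_def fun_eq_iff
    by (intro allI infsum_cong_neutral) (use disj in \<open>force simp: f_def\<close>)+
  have FN: "frame_operator {i. f2 i \<noteq> 0} f = A2"
    unfolding f2_A2[symmetric] frame_operator_def fun_eq_iff
    by (intro allI infsum_cong_neutral) (use disj in \<open>force simp: f_def\<close>)+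
  have "(T \<circ> ell2_proj {i. f1 i \<noteq> 0}) ` ell2 I = range Q"
  proof (intro equalityI subsetI)
    fix y assume "y \<in> (T \<circ> ell2_proj {i. f1 i \<noteq> 0}) ` ell2 I"
    then obtain x where "x \<in> ell2 I" "y = T (ell2_proj {i. f1 i \<noteq> 0} x)"
      by auto
    then have y: "((\<lambda>i. x i *\<^sub>C f i) has_sum y) {i. f1 i \<noteq> 0}"
      using synthesis_proj_has_sum[OF T _ sub(1)] by blast
    \<comment> \<open>Each term of the series is fixed by \<open>Q\<close>, and continuity of
      \<open>Q\<close> transfers this to the sum.\<close>
    have "((\<lambda>i. Q (x i *\<^sub>C f i)) has_sum Q y) {i. f1 i \<noteq> 0}"
      by (rule has_sum_bounded_linear[OF bounded_clinear_bounded_linear[OF lin] y])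
    moreover have "((\<lambda>i. Q (x i *\<^sub>C f i)) has_sum y) {i. f1 i \<noteq> 0} \<longleftrightarrow>
        ((\<lambda>i. x i *\<^sub>C f i) has_sum y) {i. f1 i \<noteq> 0}"
      by (rule has_sum_cong) (use disj in \<open>auto simp: f_def bounded_clinear_scaleC[OF lin]
          bounded_clinear_add[OF lin] Qf1 Qf2\<close>)
    ultimately have "Q y = y"
      using y has_sum_unique by blast
    then show "y \<in> range Q" by (metis rangeI)
  next
    fix y assume "y \<in> range Q"
    moreover obtain u where "y = S u"
      using \<open>surj S\<close> by blast
    \<comment> \<open>As \<open>Q\<close> fixes \<open>y = S u\<close>, one has
      \<open>y = Q (S u)\<close>, and \<open>J\<close> is its own inverse. Hence every vector of
      \<open>range Q\<close> is already a value of \<open>A1\<close>.\<close>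
    ultimately have "y = A1 (J u)"
      by (auto simp: A1_def idem)
    then have "y = T (ell2_proj {i. f1 i \<noteq> 0} (analysis_operator I f (J u)))"
      using synthesis_analysis[OF B T sub(1)] by (simp add: FP)
    then show "y \<in> (T \<circ> ell2_proj {i. f1 i \<noteq> 0}) ` ell2 I"
      using analysis_operator_mem[OF B] by auto
  qed
  moreover have "(T \<circ> ell2_proj {i. f2 i \<noteq> 0}) ` ell2 I = {x. Q x = 0}"
  proof (intro equalityI subsetI)
    fix y assume "y \<in> (T \<circ> ell2_proj {i. f2 i \<noteq> 0}) ` ell2 I"
    then obtain x where "x \<in> ell2 I" "y = T (ell2_proj {i. f2 i \<noteq> 0} x)"
      by auto
    then have y: "((\<lambda>i. x i *\<^sub>C f i) has_sum y) {i. f2 i \<noteq> 0}"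
      using synthesis_proj_has_sum[OF T _ sub(2)] by blast
    have "((\<lambda>i. Q (x i *\<^sub>C f i)) has_sum Q y) {i. f2 i \<noteq> 0}"
      by (rule has_sum_bounded_linear[OF bounded_clinear_bounded_linear[OF lin] y])
    moreover have "((\<lambda>i. Q (x i *\<^sub>C f i)) has_sum 0) {i. f2 i \<noteq> 0}"
      by (rule has_sum_0) (use disj in \<open>auto simp: f_def bounded_clinear_scaleC[OF lin]
          bounded_clinear_add[OF lin] Qf1 Qf2\<close>)
    ultimately show "y \<in> {x. Q x = 0}"
      using has_sum_unique by blast
  next
    fix y assume "y \<in> {x. Q x = 0}"
    moreover obtain u where "y = S u"
      using \<open>surj S\<close> by blast
    ultimately have "y = - A2 (J u)"
      by (simp add: A2_def)
    \<comment> \<open>The sign moves into the argument, which exhibits \<open>y\<close> as a value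
      of the frame operator over the negative indices.\<close>
    then have "y = A2 (- J u)"
      by (simp add: bounded_clinear_minus[OF positive_operator_clinear[OF A2]])
    then have "y = T (ell2_proj {i. f2 i \<noteq> 0} (analysis_operator I f (- J u)))"
      using synthesis_analysis[OF B T sub(2)] by (simp add: FN)
    then show "y \<in> (T \<circ> ell2_proj {i. f2 i \<noteq> 0}) ` ell2 I"
      using analysis_operator_mem[OF B] by auto
  qed
  moreover have "\<exists>x\<in>range Q. \<exists>y\<in>{x. Q x = 0}. z = x + y" for z
    by (rule bexI[of _ "Q z"], rule bexI[of _ "z - Q z"])
      (auto simp: bounded_clinear_diff[OF lin] idem)
  note uniformly_J_definite_decomp_maximal[OF rangeQ kerQ this]
  ultimately have "J_frame ip I f"
    unfolding J_frame_def P N using Bessel_bound_family[OF B] T by (intro conjI exI[of _ T]) simp_all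
  moreover have "S = T \<circ> J_adjoint (ell2 I) (ell2_inner I) (ell2_symmetry ip I f) cinner J T"
    \<comment> \<open>The difference of the two frame operators at \<open>J w\<close> is
      \<open>Q (S w) + (S w - Q (S w))\<close>.\<close>
    by (rule ext) (simp only: comp_apply synthesis_J_adjoint[OF B T] P N FP FN, simp add: A1_def A2_def)
  ultimately show ?thesis
    unfolding J_frame_operator_def using T by (intro exI conjI)
qed

end

theorem theorem5p5:
  fixes ip :: "'a::complex_hilbert_space \<Rightarrow> 'a \<Rightarrow> complex"
    and Hp Hm :: "'a set"
    and J S :: "'a \<Rightarrow> 'a"
  assumes "krein_space ip Hp Hm J"
    and "J_selfadjoint J S"
    and "boundedly_invertible S"
    and "infinite (UNIV :: 'i set)"
  shows "(J_frame_operator TYPE('i) ip J S \<longleftrightarrow>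
      (\<exists>Q \<in> Q_projections ip. J_positive ip (Q \<circ> S) \<and> J_negative ip ((\<lambda>x. x - Q x) \<circ> S)))
    \<and> ((\<exists>Q \<in> Q_projections ip. J_positive ip (Q \<circ> S) \<and> J_negative ip ((\<lambda>x. x - Q x) \<circ> S)) \<longleftrightarrow>
      (\<exists>S1 S2. J_positive ip S1 \<and> J_positive ip S2 \<and> S = (\<lambda>x. S1 x - S2 x) \<and>
        uniformly_J_positive ip (range S1) \<and> uniformly_J_negative ip (range S2)))"
proof -
  interpret krein_space ip Hp Hm J by fact
  obtain B where "S \<circ> B = id"
    using assms(3) unfolding boundedly_invertible_def by blast
  then have surj: "surj S"
    by (intro surjI[of S B]) (simp add: fun_eq_iff)
  \<comment> \<open>Here \<open>P\<close>, \<open>Q\<close>, \<open>R\<close> stand for the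
    conditions 1, 2, 3. Condition 1 is reached from 2, where the infinite index type provides room
    for a countable frame.\<close>
  have equiv: "\<lbrakk>P \<Longrightarrow> R; R \<Longrightarrow> Q; Q \<Longrightarrow> R; Q \<Longrightarrow> P\<rbrakk> \<Longrightarrow> (P \<longleftrightarrow> Q) \<and> (Q \<longleftrightarrow> R)" for P Q R
    by blast
  show ?thesis
  proof (rule equiv, goal_cases)
    case 1
    then show ?case by (rule J_frame_operator_imp_difference)
  next
    case 2
    then show ?case by (elim exE conjE) (rule difference_imp_projection[OF surj])
  next
    case 3
    then show ?case by (elim bexE conjE) (rule projection_imp_difference)
  next
    case 4
    then show ?case
      by (elim bexE conjE) (rule projection_imp_J_frame_operator[OF assms(4) surj])
  qed
qed

end
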